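(* For every integer $k$ there exists a modular knot $K$ such that $k$ is one of the coefficients of the Alexander polynomial $\Delta_K(t)$.
   Context: Words: let $\{L,R\}^*_{\mathrm{prim}}$ be the set of finite nonempty words over the alphabet $\{L,R\}$ that are primitive (not of the form $U^k$ for a shorter word $U$ and $k\ge 2$). Let $\mathrm{cyc}$ move the first letter of a word to the end. For $W\in\{L,R\}^*_{\mathrm{prim}}$ of length $m\ge 2$, for $1\le j\le m$ let $\mathrm{rank}_j(W)\in\{1,\dots,m\}$ be the rank of $\mathrm{cyc}^{j-1}(W)$ among all (distinct) cyclic permutations of $W$ in ascending lexicographic order with $L<R$, and put $\mathrm{rank}_{m+1}(W)=\mathrm{rank}_1(W)$. The modular braid $\mathbb{M}(W)$ is the $m$-strand braid joining, for each $1\le j\le m$, the $\mathrm{rank}_j(W)$-th top point to the $\mathrm{rank}_{j+1}(W)$-th bottom point by a straight segment, where at each crossing the strand starting at a top point whose cyclic permutation begins with $L$ passes over the strand starting at a top point whose cyclic permutation begins with $R$. A modular knot is the closure of $\mathbb{M}(W)$ for some $W\in\{L,R\}^*_{\mathrm{prim}}$ of length at least $2$. For a knot $K$, $\Delta_K(t)$ denotes its Alexander polynomial, normalized (by multiplication by a unit $\pm t^k$) to be a polynomial in $\mathbb{Z}[t]$ with nonzero constant term and $\Delta_K(1)=1$; "coefficient" means the coefficient of some power $t^d$, $0\le d\le \deg\Delta_K$. *)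

theory Defs
  imports "Jordan_Normal_Form.Determinant" "HOL-Computational_Algebra.Polynomial"
begin

datatype letter = L | R

definition primitive :: "letter list \<Rightarrow> bool" where
  "primitive W \<longleftrightarrow> W \<noteq> [] \<and>
     \<not> (\<exists>U k. k \<ge> 2 \<and> W = concat (replicate k U))"

definition lex_less :: "letter list \<Rightarrow> letter list \<Rightarrow> bool" where
  "lex_less U V \<longleftrightarrow> length U = length V \<and>
     (\<exists>i < length U. take i U = take i V \<and> U ! i = L \<and> V ! i = R)"

definition cyc_perms :: "letter list \<Rightarrow> letter list set" where
  "cyc_perms W = {rotate i W | i. i < length W}"

text \<open>rank0 W j = rank_{j+1}(W) - 1 (0-based), for 0 <= j < length W: the number
  of distinct cyclic permutations of W lexicographically smaller than cyc^j(W).\<close>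
definition rank0 :: "letter list \<Rightarrow> nat \<Rightarrow> nat" where
  "rank0 W j = card {V \<in> cyc_perms W. lex_less V (rotate j W)}"

text \<open>Strands of the modular braid listed by their (0-based) top point p:
  (bottom point, strand starts with L).  The strand j joins top point rank0 W j to
  bottom point rank0 W ((j+1) mod m).\<close>
definition strands :: "letter list \<Rightarrow> (nat \<times> bool) list" where
  "strands W = map (\<lambda>p. let m = length W; j = (THE j. j < m \<and> rank0 W j = p)
       in (rank0 W ((j + 1) mod m), W ! j = L)) [0..<length W]"

text \<open>One bubble pass.  A swap of the strands at positions i, i+1 is recorded
  as the Artin generator (i, b): b = True means sigma_i (left strand passes over),
  b = False means sigma_i inverse; the L-strand passes over the R-strand.\<close>
fun bpass :: "nat \<Rightarrow> (nat \<times> bool) list \<Rightarrow> (nat \<times> bool) list \<times> (nat \<times> bool) list" where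
  "bpass i (a # b # xs) =
     (if fst a > fst b
      then (let (ys, g) = bpass (Suc i) (a # xs) in (b # ys, (i, snd a) # g))
      else (let (ys, g) = bpass (Suc i) (b # xs) in (a # ys, g)))"
| "bpass i xs = (xs, [])"

fun bsort :: "nat \<Rightarrow> (nat \<times> bool) list \<Rightarrow> (nat \<times> bool) list" where
  "bsort 0 xs = []"
| "bsort (Suc n) xs = (let (ys, g) = bpass 0 xs in g @ bsort n ys)"

definition modular_braid :: "letter list \<Rightarrow> (nat \<times> bool) list" where
  "modular_braid W = bsort (length W) (strands W)"

definition burau_gen :: "nat \<Rightarrow> real \<Rightarrow> nat \<times> bool \<Rightarrow> real mat" where
  "burau_gen m t g = (let i = fst g in mat m m (\<lambda>(r, c).
     if r = i \<and> c = i then (if snd g then 1 - t else 0)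
     else if r = i \<and> c = i + 1 then (if snd g then t else 1)
     else if r = i + 1 \<and> c = i then (if snd g then 1 else 1 / t)
     else if r = i + 1 \<and> c = i + 1 then (if snd g then 0 else 1 - 1 / t)
     else if r = c then 1 else 0))"

definition burau :: "nat \<Rightarrow> real \<Rightarrow> (nat \<times> bool) list \<Rightarrow> real mat" where
  "burau m t ws = foldr (\<lambda>g B. burau_gen m t g * B) ws (1\<^sub>m m)"

text \<open>Alexander polynomial of the closure of an m-strand braid word ws, via the
  Burau representation: the (1,1)-minor of I - Burau(ws) equals Delta up to a unit +-t^e.
  is_alexander m ws p: p is the normalized Alexander polynomial (integer coefficients,
  nonzero constant term, p(1) = 1).\<close>
definition is_alexander :: "nat \<Rightarrow> (nat \<times> bool) list \<Rightarrow> int poly \<Rightarrow> bool" where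
  "is_alexander m ws p \<longleftrightarrow> coeff p 0 \<noteq> 0 \<and> poly p 1 = 1 \<and>
     (\<exists>\<epsilon> \<in> {1, -1::real}. \<exists>e::int. \<forall>t::real. t > 0 \<longrightarrow>
        \<epsilon> * t powr (of_int e) * poly (map_poly real_of_int p) t
          = det (mat_delete (1\<^sub>m m - burau m t ws) 0 0))"

definition modular_knot_word :: "letter list \<Rightarrow> bool" where
  "modular_knot_word W \<longleftrightarrow> primitive W \<and> length W \<ge> 2"

end

theory Submission
  imports Defs "HOL-Computational_Algebra.Polynomial_FPS"
begin

text \<open>
  A Lorenz permutation, that is, a cyclic permutation of the \<open>m\<close> points that is increasing on an
  initial segment of left points and on the remaining right points, is read off from the cyclic
  word of its itinerary, and conversely the modular braid of that word is its positive Lorenz braid.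
  The Burau matrix of this braid is explicit, since a left strand crosses right strands only. In
  the minor of \<open>1 - B\<close> all left points can be eliminated by following the permutation, which leaves
  a determinant whose size is the number of right points.

  With \<open>12k + 1\<close> left and six right points, chosen as in \<open>lorenz_map\<close>, the resulting polynomial \<open>p\<close>
  satisfies
  \<open>p (1 - t ^ 6)\<^sup>2 = (1 - t) (1 - t ^ 6) + (1 - t)\<^sup>2 (1 + t\<^sup>2 + t ^ 4) t ^ (6k + 2) + O(t ^ (12k + 1))\<close>.
  Hence the coefficients of degrees between \<open>6k + 2\<close> and \<open>12k\<close> in a fixed residue class modulo 6 form
  arithmetic progressions with difference \<open>2\<close> or \<open>-2\<close>, and every integer occurs for some \<open>k\<close>.
\<close>

section \<open>Modular braids of Lorenz permutations\<close>

lemma lex_less_irrefl: "\<not> lex_less U U"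
  by (auto simp: lex_less_def)

lemma lex_less_asym:
  assumes "lex_less U V" shows "\<not> lex_less V U"
proof
  assume "lex_less V U"
  then obtain j where j: "j < length V" "take j V = take j U" "V ! j = L" "U ! j = R"
    by (auto simp: lex_less_def)
  from assms obtain i where i: "i < length U" "take i U = take i V" "U ! i = L" "V ! i = R"
    by (auto simp: lex_less_def)
  show False
  proof (cases i j rule: linorder_cases)
    case less
    then have "V ! i = U ! i" using j(2) by (metis nth_take)
    then show ?thesis using i by simp
  next
    case equal
    then show ?thesis using i j by simp
  next
    case greater
    then have "V ! j = U ! j" using i(2) by (metis nth_take)
    then show ?thesis using j by simp
  qed
qed

text \<open>Points below \<open>l\<close> are the left ones. By \<open>transitive\<close> the
  permutation is a single cycle, so one cyclic word records all of it and its braid closes to a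
  knot.\<close>

locale lorenz_cycle =
  fixes m l :: nat and f :: "nat \<Rightarrow> nat"
  assumes two_le: "2 \<le> m"
    and maps_to: "p < m \<Longrightarrow> f p < m"
    and inj: "inj_on f {..<m}"
    and mono_left: "p < q \<Longrightarrow> q < l \<Longrightarrow> f p < f q"
    and mono_right: "l \<le> p \<Longrightarrow> p < q \<Longrightarrow> q < m \<Longrightarrow> f p < f q"
    and transitive: "p < m \<Longrightarrow> \<exists>j. p = (f ^^ j) 0"
begin

section \<open>The orbit of the point 0\<close>

definition orb :: "nat \<Rightarrow> nat" where "orb j = (f ^^ j) 0"

lemma orb_Suc: "orb (Suc j) = f (orb j)"
  by (simp add: orb_def)

lemma orb_less: "orb j < m"
  using two_le by (induction j) (auto simp: orb_def maps_to)

lemma orb_shift: "orb i = orb j \<Longrightarrow> orb (i + n) = orb (j + n)"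
  by (induction n) (auto simp: orb_Suc)

text \<open>A repetition at times \<open>i < j\<close> would confine the whole orbit to its first
  \<open>j\<close> values, too few to reach all \<open>m\<close> points.\<close>

lemma orb_inj: "inj_on orb {..<m}"
proof (rule linorder_inj_onI)
  fix i j assume "i < j" and j: "j \<in> {..<m}"
  show "orb i \<noteq> orb j"
  proof
    assume eq: "orb i = orb j"
    have "orb n \<in> orb ` {..<j}" for n
    proof (induction n)
      case 0 then show ?case using \<open>i < j\<close> by auto
    next
      case (Suc n)
      then obtain r where r: "r < j" "orb n = orb r" by auto
      then have "orb (Suc n) = orb (Suc r)" by (simp add: orb_Suc)
      then show ?case using r eq \<open>i < j\<close> by (cases "Suc r = j") (auto intro: image_eqI[of _ _ i])
    qed
    then have "{..<m} \<subseteq> orb ` {..<j}"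
      using transitive by (force simp: orb_def)
    then have "m \<le> j"
      by (metis card_image_le card_lessThan card_mono finite_imageI finite_lessThan le_trans)
    then show False using j by simp
  qed
qed auto

lemma orb_image: "orb ` {..<m} = {..<m}"
  by (rule endo_inj_surj) (auto simp: orb_less orb_inj)

lemma orb_surj:
  assumes "p < m" obtains j where "j < m" "orb j = p"
proof -
  have "p \<in> orb ` {..<m}" unfolding orb_image using assms by simp
  then show thesis using that by auto
qed

text \<open>Some earlier value recurs at time \<open>m\<close>. If it were
  \<open>orb (Suc i)\<close>, injectivity of \<open>f\<close> would give a repetition one step
  earlier, against \<open>orb_inj\<close>.\<close>

lemma orb_m: "orb m = 0"
proof -
  obtain j where j: "j < m" "orb m = orb j"
    using orb_surj[OF orb_less[of m]] by metis
  show ?thesis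
  proof (cases j)
    case 0 then show ?thesis using j by (simp add: orb_def)
  next
    case (Suc i)
    obtain n where n: "m = Suc n" using two_le by (cases m) auto
    have "f (orb n) = f (orb i)" using j Suc n by (simp add: orb_Suc)
    then have "orb n = orb i" using inj orb_less by (simp add: inj_on_def)
    then have "n = i" using orb_inj n Suc j by (simp add: inj_on_def)
    then show ?thesis using Suc n j by simp
  qed
qed

lemma orb_add_m: "orb (n + m) = orb n"
  using orb_shift[of m 0 n] orb_m by (simp add: orb_def add.commute)

lemma orb_mod: "orb (n mod m) = orb n"
proof -
  have "orb (n mod m + m * k) = orb (n mod m)" for k
  proof (induction k)
    case (Suc k)
    then show ?case using orb_add_m[of "n mod m + m * k"] by (simp add: ac_simps)
  qed simp
  from this[of "n div m"] show ?thesis by simp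
qed

section \<open>The itinerary word and its modular braid\<close>

definition word :: "letter list" where
  "word = map (\<lambda>j. if orb j < l then L else R) [0..<m]"

lemma length_word: "length word = m"
  by (simp add: word_def)

lemma nth_rotate_word: "n < m \<Longrightarrow> rotate i word ! n = (if orb (i + n) < l then L else R)"
  by (simp add: nth_rotate length_word orb_mod) (simp add: word_def orb_mod)

lemma orb_less_step:
  assumes "orb i < orb j" "orb i < l \<longleftrightarrow> orb j < l"
  shows "orb (Suc i) < orb (Suc j)"
proof (cases "orb j < l")
  case True
  then show ?thesis using mono_left[OF assms(1)] by (simp add: orb_Suc)
next
  case False
  then have "l \<le> orb i" using assms(2) by simp
  then show ?thesis using mono_right[OF _ assms(1) orb_less] by (simp add: orb_Suc)
qed

lemma orb_less_steps:
  assumes "orb i < orb j" "\<And>k. k < n \<Longrightarrow> orb (i + k) < l \<longleftrightarrow> orb (j + k) < l"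
  shows "orb (i + n) < orb (j + n)"
  using assms(2)
proof (induction n)
  case (Suc n)
  then show ?case using orb_less_step[of "i + n" "j + n"] by simp
qed (use assms(1) in simp)

text \<open>If the itineraries of two points agreed forever, the power of \<open>f\<close> carrying the smaller
  point to the larger one would move it upwards indefinitely.\<close>
lemma orb_separated:
  assumes "orb i < orb j" "i < m"
  shows "\<exists>n<m. (orb (i + n) < l) \<noteq> (orb (j + n) < l)"
proof (rule ccontr)
  assume "\<not> ?thesis"
  then have "orb (i + n mod m) < l \<longleftrightarrow> orb (j + n mod m) < l" for n
    using two_le by auto
  then have "orb (i + n) < l \<longleftrightarrow> orb (j + n) < l" for n
    by (metis mod_add_right_eq orb_mod)
  then have step: "orb (i + n) < orb (j + n)" for n
    using orb_less_steps assms(1) by blast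
  \<comment> \<open>In \<open>d\<close> steps \<open>orb i\<close> moves to \<open>orb j\<close>;
    adding \<open>m\<close> keeps the subtraction from being truncated.\<close>
  define d where "d = j + m - i"
  have "orb (i + d) = orb j" using assms(2) orb_add_m by (simp add: d_def)
  then have up: "orb (i + n) < orb (i + n + d)" for n
    using step[of n] orb_shift[of "i + d" j n] by (simp add: ac_simps)
  have "strict_mono (\<lambda>r. orb (i + r * d))"
    unfolding strict_mono_Suc_iff using up[of "_ * d"] by (simp add: ac_simps)
  then have "m \<le> orb (i + m * d)"
    by (rule seq_suble)
  then show False using orb_less[of "i + m * d"] by simp
qed

text \<open>\<open>f\<close> preserves the order of two points on the same side. At the first
  difference of the itineraries the smaller point is therefore still smaller, hence the left one,
  which is written \<open>L\<close>.\<close>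

lemma lex_less_of_orb:
  assumes "orb i < orb j" "i < m"
  shows "lex_less (rotate i word) (rotate j word)"
proof -
  define n where "n = (LEAST n. (orb (i + n) < l) \<noteq> (orb (j + n) < l))"
  obtain n0 where n0: "n0 < m" "(orb (i + n0) < l) \<noteq> (orb (j + n0) < l)"
    using orb_separated[OF assms] by blast
  have n: "(orb (i + n) < l) \<noteq> (orb (j + n) < l)"
    unfolding n_def by (rule LeastI[of _ n0]) (rule n0(2))
  have "n \<le> n0" unfolding n_def by (rule Least_le) (rule n0(2))
  then have "n < m" using n0(1) by simp
  have before: "orb (i + k) < l \<longleftrightarrow> orb (j + k) < l" if "k < n" for k
    using not_less_Least[OF that[unfolded n_def]] by simp
  have "orb (i + n) < orb (j + n)"
    using orb_less_steps assms(1) before by blast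
  then have "orb (i + n) < l" "\<not> orb (j + n) < l" using n by auto
  moreover have "take n (rotate i word) = take n (rotate j word)"
    using before \<open>n < m\<close> by (intro nth_equalityI) (auto simp: length_word nth_rotate_word)
  ultimately show ?thesis
    unfolding lex_less_def using \<open>n < m\<close> by (auto simp: length_word nth_rotate_word intro!: exI[of _ n])
qed

lemma lex_less_iff:
  assumes "i < m" "j < m"
  shows "lex_less (rotate i word) (rotate j word) \<longleftrightarrow> orb i < orb j"
proof (cases "orb i" "orb j" rule: linorder_cases)
  case equal
  then have "i = j" using orb_inj assms by (simp add: inj_on_def)
  then show ?thesis by (simp add: lex_less_irrefl)
qed (use lex_less_of_orb lex_less_asym assms in \<open>auto dest: less_not_sym\<close>)

lemma rotate_inj: "inj_on (\<lambda>i. rotate i word) {..<m}"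
proof (rule inj_onI)
  fix i j assume "i \<in> {..<m}" "j \<in> {..<m}" and eq: "rotate i word = rotate j word"
  then have "\<not> orb i < orb j" "\<not> orb j < orb i"
    using lex_less_iff lex_less_irrefl by (metis lessThan_iff)+
  then have "orb i = orb j" by simp
  with orb_inj show "i = j" using \<open>i \<in> _\<close> \<open>j \<in> _\<close> by (auto simp: inj_on_def)
qed

text \<open>The smaller cyclic permutations correspond to the orbit points below
  \<open>orb j\<close>; since the orbit fills \<open>{..<m}\<close>, there are \<open>orb j\<close>
  of them.\<close>

lemma rank0_word:
  assumes "j < m"
  shows "rank0 word j = orb j"
proof -
  have "{V \<in> cyc_perms word. lex_less V (rotate j word)} = (\<lambda>i. rotate i word) ` {i. i < m \<and> orb i < orb j}"
    using assms by (auto simp: cyc_perms_def length_word lex_less_iff)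
  moreover have "inj_on (\<lambda>i. rotate i word) {i. i < m \<and> orb i < orb j}"
    by (rule inj_on_subset[OF rotate_inj]) auto
  ultimately have "rank0 word j = card {i. i < m \<and> orb i < orb j}"
    by (simp add: rank0_def card_image)
  also have "\<dots> = card (orb ` {i. i < m \<and> orb i < orb j})"
    by (rule card_image[symmetric], rule inj_on_subset[OF orb_inj]) auto
  also have "orb ` {i. i < m \<and> orb i < orb j} = {..<orb j}"
  proof -
    have "x \<in> orb ` {i. i < m \<and> orb i < orb j}" if "x < orb j" for x
    proof -
      have "x < m" using that orb_less[of j] by simp
      then obtain i where "i < m" "orb i = x" by (rule orb_surj)
      then show ?thesis using that by auto
    qed
    then show ?thesis by auto
  qed
  finally show ?thesis by simp
qed

text \<open>With ranks identified with points, the strand at \<open>p = orb j\<close> ends at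
  \<open>orb (Suc j) = f p\<close>; injectivity of the orbit settles the definite
  description.\<close>

lemma strands_word: "strands word = map (\<lambda>p. (f p, p < l)) [0..<m]"
proof -
  have "(let j = THE j. j < m \<and> rank0 word j = p
       in (rank0 word ((j + 1) mod m), word ! j = L)) = (f p, p < l)" if "p < m" for p
  proof -
    obtain j where j: "j < m" "orb j = p" using orb_surj \<open>p < m\<close> by blast
    have "i = j" if "i < m \<and> rank0 word i = p" for i
      using that j inj_onD[OF orb_inj, of i j] by (auto simp: rank0_word)
    then have "(THE j. j < m \<and> rank0 word j = p) = j"
      using j by (intro the_equality) (simp_all add: rank0_word)
    moreover have "rank0 word (Suc j mod m) = f p"
      using j two_le by (simp add: rank0_word orb_mod orb_Suc)
    ultimately show ?thesis using j by (simp add: word_def)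
  qed
  then show ?thesis by (simp add: strands_def length_word Let_def)
qed

text \<open>A proper power is fixed by rotation through the length of its root, but the
  \<open>m\<close> rotations of \<open>word\<close> are distinct.\<close>

lemma primitive_word: "primitive word"
proof -
  have False if k: "2 \<le> k" and eq: "word = concat (replicate k U)" for k U
  proof -
    obtain n where n: "k = Suc (Suc n)" using k by (metis add_2_eq_Suc le_Suc_ex)
    have "concat (replicate i U) @ U = U @ concat (replicate i U)" for i
      by (induction i) auto
    then have "rotate (length U) word = word"
      unfolding eq n by (simp add: rotate_append)
    moreover have m: "m = k * length U" using arg_cong[OF eq, of length]
      by (simp add: length_word length_concat sum_list_replicate)
    have "0 < length U" using m two_le by (intro gr0I) simp
    moreover from this have "1 * length U < k * length U"
      using k by (intro mult_strict_right_mono) auto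
    ultimately show False
      using inj_onD[OF rotate_inj, of "length U" 0] m two_le by simp
  qed
  moreover have "word \<noteq> []" using length_word two_le by auto
  ultimately show ?thesis unfolding primitive_def by blast
qed

end

section \<open>The Burau matrix of a Lorenz braid\<close>

text \<open>Row of a Burau matrix in Jones' random walk picture: a walker on a strand with destination \<open>d\<close>
  meets the strands \<open>xs\<close> to its right in order; at each crossing it stays on its own strand with
  weight \<open>t\<close> and otherwise falls onto the under strand, which it never leaves again.\<close>
fun walk :: "real \<Rightarrow> nat \<Rightarrow> (nat \<times> bool) list \<Rightarrow> nat \<Rightarrow> real" where
  "walk t d [] c = (if c = d then 1 else 0)"
| "walk t d (x # xs) c = (if fst x < d
     then (1 - t) * (if c = fst x then 1 else 0) + t * walk t d xs c else walk t d xs c)"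

definition walk_mat :: "real \<Rightarrow> (nat \<times> bool) list \<Rightarrow> real mat" where
  "walk_mat t xs = mat (length xs) (length xs)
     (\<lambda>(r, c). walk t (fst (xs ! r)) (drop (Suc r) xs) c)"

text \<open>Only a left strand followed by a right strand may cross, so every crossing of the
  bubble sort is a positive generator.\<close>
fun lr :: "(nat \<times> bool) list \<Rightarrow> bool" where
  "lr [] \<longleftrightarrow> True"
| "lr (x # xs) \<longleftrightarrow> (\<forall>y \<in> set xs. fst y < fst x \<longrightarrow> snd x \<and> \<not> snd y) \<and> lr xs"

lemma walk_none: "(\<And>x. x \<in> set xs \<Longrightarrow> \<not> fst x < d) \<Longrightarrow> walk t d xs c = (if c = d then 1 else 0)"
  by (induction xs) auto

lemma walk_swap:
  assumes "\<not> (fst a < d \<and> fst b < d)"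
  shows "walk t d (us @ a # b # vs) c = walk t d (us @ b # a # vs) c"
  using assms by (induction us) auto

lemma burau_gen_carrier [simp]: "burau_gen m t g \<in> carrier_mat m m"
  by (simp add: burau_gen_def Let_def)

lemma index_burau_gen_mult:
  assumes "A \<in> carrier_mat m m" "Suc i < m" "r < m" "c < m"
  shows "(burau_gen m t (i, True) * A) $$ (r, c) =
    (if r = i then (1 - t) * A $$ (i, c) + t * A $$ (Suc i, c)
     else if r = Suc i then A $$ (i, c) else A $$ (r, c))"
proof -
  let ?g = "\<lambda>r j. if r = i then (if j = i then 1 - t else if j = Suc i then t else 0)
     else if r = Suc i then (if j = i then 1 else 0) else if j = r then 1 else 0"
  have "(burau_gen m t (i, True) * A) $$ (r, c) = (\<Sum>j<m. ?g r j * A $$ (j, c))"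
    using assms by (auto simp: burau_gen_def Let_def scalar_prod_def lessThan_atLeast0 intro!: sum.cong)
  also have "\<dots> = (\<Sum>j\<in>{r, i, Suc i}. ?g r j * A $$ (j, c))"
    using assms by (intro sum.mono_neutral_right) auto
  also have "\<dots> = (if r = i then (1 - t) * A $$ (i, c) + t * A $$ (Suc i, c)
     else if r = Suc i then A $$ (i, c) else A $$ (r, c))"
    by (cases "r = Suc i") (auto simp: insert_commute)
  finally show ?thesis .
qed

text \<open>At the crossing \<open>a\<close> stays on its strand with weight \<open>t\<close> or
  falls onto \<open>b\<close>, a right strand that passes over nothing, so that its row is a unit
  vector. Rows further left are unchanged: no strand there passes over the left strand
  \<open>a\<close>, so \<open>walk_swap\<close> applies.\<close>

lemma walk_mat_swap:
  assumes "lr (us @ a # b # vs)" "fst b < fst a" "m = length (us @ a # b # vs)"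
  shows "walk_mat t (us @ a # b # vs) =
    burau_gen m t (length us, True) * walk_mat t (us @ b # a # vs)"
proof (rule eq_matI)
  let ?n = "length us" and ?xs = "us @ a # b # vs" and ?ys = "us @ b # a # vs"
  have inv: "fst y < fst x \<Longrightarrow> snd x \<and> \<not> snd y"
    if "x \<in> set us" "y \<in> {a, b}" for x y
    using assms(1) that by (induction us) auto
  have ab: "snd a" "\<not> snd b" "\<And>y. y \<in> set vs \<Longrightarrow> \<not> fst y < fst b"
    using assms(1,2) by (induction us) auto
  fix r c assume rc: "r < dim_row (burau_gen m t (?n, True) * walk_mat t ?ys)"
    "c < dim_col (burau_gen m t (?n, True) * walk_mat t ?ys)"
  then have r: "r < m" and c: "c < m" using assms(3) by (auto simp: walk_mat_def burau_gen_def Let_def)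
  have Y: "walk_mat t ?ys \<in> carrier_mat m m" using assms(3) by (simp add: walk_mat_def)
  have lhs: "walk_mat t ?xs $$ (r, c) = walk t (fst (?xs ! r)) (drop (Suc r) ?xs) c"
    using r c assms(3) by (simp add: walk_mat_def)
  have rhs: "walk_mat t ?ys $$ (r, c) = walk t (fst (?ys ! r)) (drop (Suc r) ?ys) c" if "r < m" for r
    using that c assms(3) by (simp add: walk_mat_def)
  have a_row: "walk_mat t ?ys $$ (Suc ?n, c) = walk t (fst a) vs c"
    using rhs[of "Suc ?n"] assms(3) by (simp add: nth_append)
  have b_row: "walk_mat t ?ys $$ (?n, c) = (if c = fst b then 1 else 0)"
    using rhs[of ?n] assms(2,3) walk_none[of vs "fst b" t c] ab(3) by (simp add: nth_append)
  consider "r < ?n" | "r = ?n" | "r = Suc ?n" | "r > Suc ?n" by linarith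
  then have "walk_mat t ?xs $$ (r, c) = (burau_gen m t (?n, True) * walk_mat t ?ys) $$ (r, c)"
  proof cases
    case 1
    have "\<not> (fst a < fst (us ! r) \<and> fst b < fst (us ! r))"
      using inv[of "us ! r" a] 1 ab(1) by auto
    then have "walk t (fst (us ! r)) (drop (Suc r) us @ a # b # vs) c
        = walk t (fst (us ! r)) (drop (Suc r) us @ b # a # vs) c"
      by (rule walk_swap)
    then show ?thesis
      using 1 lhs rhs[OF r] assms(3)
      by (subst index_burau_gen_mult[OF Y _ r c]) (auto simp: nth_append Suc_le_eq)
  next
    case 2
    then show ?thesis
      using lhs assms(2,3) a_row b_row
      by (subst index_burau_gen_mult[OF Y _ r c]) (auto simp: nth_append)
  next
    case 3
    then show ?thesis
      using lhs assms(3) walk_none[of vs "fst b" t c] ab(3) b_row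
      by (subst index_burau_gen_mult[OF Y _ r c]) (auto simp: nth_append)
  next
    case 4
    then obtain q where q: "r = Suc (Suc (?n + q))"
      by (metis add_Suc less_imp_Suc_add)
    show ?thesis
      using lhs rhs[OF r] assms(3) q
      by (subst index_burau_gen_mult[OF Y _ r c]) (auto simp: nth_append Suc_diff_le)
  qed
  then show "walk_mat t ?xs $$ (r, c) = (burau_gen m t (?n, True) * walk_mat t ?ys) $$ (r, c)" .
qed (use assms(3) in \<open>auto simp: walk_mat_def burau_gen_def Let_def\<close>)

lemma lr_swap: "lr (us @ a # b # vs) \<Longrightarrow> fst b < fst a \<Longrightarrow> lr (us @ b # a # vs)"
  by (induction us) auto

lemma walk_mat_carrier: "walk_mat t xs \<in> carrier_mat (length xs) (length xs)"
  by (simp add: walk_mat_def)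

lemma burau_carrier: "burau m t ws \<in> carrier_mat m m"
  unfolding burau_def by (induction ws) (auto intro!: mult_carrier_mat)

lemma burau_Cons: "burau m t (g # ws) = burau_gen m t g * burau m t ws"
  by (simp add: burau_def)

lemma burau_append: "burau m t (us @ vs) = burau m t us * burau m t vs"
proof (induction us)
  case Nil
  then show ?case using burau_carrier[of m t vs] by (simp add: burau_def)
next
  case (Cons g us)
  then show ?case
    by (simp add: burau_Cons assoc_mult_mat[OF burau_gen_carrier burau_carrier burau_carrier])
qed

section \<open>Bubble sort as multiplication by Burau generators\<close>

lemma length_bpass: "bpass i xs = (ys, g) \<Longrightarrow> length ys = length xs"
  by (induction i xs arbitrary: ys g rule: bpass.induct) (auto split: if_splits prod.splits)

lemma mset_bpass: "bpass i xs = (ys, g) \<Longrightarrow> mset ys = mset xs"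
  by (induction i xs arbitrary: ys g rule: bpass.induct) (auto split: if_splits prod.splits)

lemma lr_append_snd: "lr (us @ vs) \<Longrightarrow> lr vs"
  by (induction us) auto

text \<open>\<open>us\<close> holds the strands already left behind, so its length is the position
  and thus the generator index of the next swap.\<close>

lemma bpass_walk_mat:
  assumes "bpass (length us) xs = (ys, g)" "lr (us @ xs)" "m = length (us @ xs)"
  shows "lr (us @ ys) \<and> walk_mat t (us @ xs) = burau m t g * walk_mat t (us @ ys)"
  using assms
proof (induction "length us" xs arbitrary: us ys g rule: bpass.induct)
  case (1 a b xs)
  show ?case
  proof (cases "fst a > fst b")
    case True
    obtain zs h where zh: "bpass (Suc (length us)) (a # xs) = (zs, h)" by fastforce
    have yg: "ys = b # zs" "g = (length us, True) # h"
      using 1(3) True zh lr_append_snd[OF 1(4)] by auto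
    have lr': "lr ((us @ [b]) @ a # xs)" using lr_swap[OF 1(4)] True by simp
    have IH: "lr ((us @ [b]) @ zs) \<and> walk_mat t ((us @ [b]) @ a # xs) = burau m t h * walk_mat t ((us @ [b]) @ zs)"
      using True zh lr' 1(5) by (intro 1(1)) auto
    have carr: "walk_mat t (us @ b # zs) \<in> carrier_mat m m"
      using walk_mat_carrier[of t "us @ b # zs"] length_bpass[OF zh] 1(5) by simp
    show ?thesis
      using IH walk_mat_swap[OF 1(4) True 1(5)]
      by (simp add: yg burau_Cons assoc_mult_mat[OF burau_gen_carrier burau_carrier carr])
  next
    case False
    obtain zs h where zh: "bpass (Suc (length us)) (b # xs) = (zs, h)" by fastforce
    have yg: "ys = a # zs" "g = h" using 1(3) False zh by auto
    have "lr ((us @ [a]) @ zs) \<and> walk_mat t ((us @ [a]) @ b # xs) = burau m t h * walk_mat t ((us @ [a]) @ zs)"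
      using False zh 1(4,5) by (intro 1(2)) auto
    then show ?thesis by (simp add: yg)
  qed
qed (auto simp: burau_def intro!: left_mult_one_mat[symmetric] walk_mat_carrier[THEN carrier_matD(1)] simp: walk_mat_def)

lemma bpass_sorted: "sorted (map fst xs) \<Longrightarrow> bpass i xs = (xs, [])"
  by (induction i xs rule: bpass.induct) auto

text \<open>A pass carries a strand \<open>z\<close> of largest destination in the unsorted part up
  to the sorted tail \<open>vs\<close>, which thereby grows by one.\<close>

lemma bpass_append:
  assumes "sorted (map fst vs)" "\<And>u v. u \<in> set (a # us) \<Longrightarrow> v \<in> set vs \<Longrightarrow> fst u \<le> fst v"
  shows "\<exists>us' z g. bpass i (a # us @ vs) = (us' @ z # vs, g) \<and> mset (us' @ [z]) = mset (a # us) \<and>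
    (\<forall>u \<in> set us'. fst u \<le> fst z)"
  using assms(2)
proof (induction us arbitrary: a i)
  case Nil
  then have "bpass i (a # vs) = (a # vs, [])" using assms(1) by (intro bpass_sorted) auto
  then show ?case by (intro exI[of _ "[]"]) auto
next
  case (Cons b us)
  \<comment> \<open>\<open>?x\<close> is the strand carried on by the pass, \<open>?y\<close> the
    one left behind.\<close>
  let ?x = "if fst a > fst b then a else b" and ?y = "if fst a > fst b then b else a"
  have "fst u \<le> fst v" if "u \<in> set (?x # us)" "v \<in> set vs" for u v
    using that Cons.prems[of u v] by (auto split: if_splits)
  then obtain us' z g where IH: "bpass (Suc i) (?x # us @ vs) = (us' @ z # vs, g)"
    "mset (us' @ [z]) = mset (?x # us)" "\<forall>u \<in> set us'. fst u \<le> fst z"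
    using Cons.IH[of ?x "Suc i"] by blast
  have "?x \<in> set (us' @ [z])" using IH(2) by (metis list.set_intros(1) set_mset_mset)
  then have "fst ?x \<le> fst z" using IH(3) by auto
  then have "fst ?y \<le> fst z" by (auto split: if_splits)
  moreover obtain h where "bpass i (a # (b # us) @ vs) = ((?y # us') @ z # vs, h)"
    using IH(1) by (cases "fst a > fst b") auto
  moreover have "mset ((?y # us') @ [z]) = mset (a # b # us)" using IH(2) by auto
  ultimately show ?case using IH(3)
    by (intro exI[of _ "?y # us'"] exI[of _ z] exI[of _ h]) simp
qed

text \<open>Each pass shortens the unsorted part \<open>us\<close> and contributes its generators on
  the left, so as many passes as \<open>us\<close> has strands suffice.\<close>

lemma bsort_walk_mat:
  assumes "lr (us @ vs)" "length us \<le> n" "sorted (map fst vs)"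
    "\<And>u v. u \<in> set us \<Longrightarrow> v \<in> set vs \<Longrightarrow> fst u \<le> fst v" "m = length (us @ vs)"
  shows "\<exists>ys. mset ys = mset (us @ vs) \<and> sorted (map fst ys) \<and>
    walk_mat t (us @ vs) = burau m t (bsort n (us @ vs)) * walk_mat t ys"
  using assms
proof (induction n arbitrary: us vs)
  case 0
  then have "walk_mat t vs = 1\<^sub>m m * walk_mat t vs"
    using left_mult_one_mat[OF walk_mat_carrier, of vs t] by simp
  then show ?case using 0 by (intro exI[of _ vs]) (auto simp: burau_def)
next
  case (Suc n)
  obtain xs g where b: "bpass 0 (us @ vs) = (xs, g)" by fastforce
  have step: "lr xs" "walk_mat t (us @ vs) = burau m t g * walk_mat t xs"
    using bpass_walk_mat[of "[]" "us @ vs"] b Suc.prems by auto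
  have "\<exists>us' vs'. xs = us' @ vs' \<and> length us' \<le> n \<and> sorted (map fst vs') \<and>
      (\<forall>u \<in> set us'. \<forall>v \<in> set vs'. fst u \<le> fst v)"
  proof (cases us)
    case Nil
    then show ?thesis using bpass_sorted Suc.prems(3) b by (intro exI[of _ "[]"] exI[of _ vs]) auto
  next
    case (Cons a ws)
    then obtain us' z h where z: "bpass 0 (us @ vs) = (us' @ z # vs, h)"
      "mset (us' @ [z]) = mset us" "\<forall>u \<in> set us'. fst u \<le> fst z"
      using bpass_append[of vs a ws 0] Suc.prems(3,4) by auto
    have "set us = set (us' @ [z])" using z(2) by (metis set_mset_mset)
    moreover have "length us = Suc (length us')" using arg_cong[OF z(2), of size] by simp
    ultimately show ?thesis using z b Suc.prems(2-4)
      by (intro exI[of _ us'] exI[of _ "z # vs"]) auto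
  qed
  then obtain us' vs' where uv: "xs = us' @ vs'" "length us' \<le> n" "sorted (map fst vs')"
    "\<And>u v. u \<in> set us' \<Longrightarrow> v \<in> set vs' \<Longrightarrow> fst u \<le> fst v" by blast
  have "length xs = m" using length_bpass[OF b] Suc.prems(5) by simp
  then obtain ys where ys: "mset ys = mset xs" "sorted (map fst ys)"
    "walk_mat t xs = burau m t (bsort n xs) * walk_mat t ys"
    using Suc.IH[of us' vs'] uv step(1) by auto
  have "length ys = m" using ys(1) \<open>length xs = m\<close> mset_eq_length by metis
  then have "walk_mat t ys \<in> carrier_mat m m" using walk_mat_carrier by metis
  then have "walk_mat t (us @ vs) = burau m t (bsort (Suc n) (us @ vs)) * walk_mat t ys"
    using step(2) ys(3) b
    by (simp add: burau_append assoc_mult_mat[OF burau_carrier burau_carrier])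
  then show ?case using ys mset_bpass[OF b] by auto
qed

lemma walk_mat_sorted:
  assumes "map fst xs = [0..<length xs]"
  shows "walk_mat t xs = 1\<^sub>m (length xs)"
proof (rule eq_matI)
  fix r c assume "r < dim_row (1\<^sub>m (length xs))" "c < dim_col (1\<^sub>m (length xs))"
  then have rc: "r < length xs" "c < length xs" by auto
  have nth: "fst (xs ! i) = i" if "i < length xs" for i
    using that arg_cong[OF assms, of "\<lambda>ys. ys ! i"] by simp
  have "\<not> fst x < fst (xs ! r)" if "x \<in> set (drop (Suc r) xs)" for x
  proof -
    obtain q where "q < length xs - Suc r" "x = xs ! (Suc r + q)"
      using \<open>x \<in> _\<close> by (auto simp: in_set_conv_nth)
    then show ?thesis using nth rc by simp
  qed
  then show "walk_mat t xs $$ (r, c) = 1\<^sub>m (length xs) $$ (r, c)"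
    using rc nth by (auto simp: walk_mat_def walk_none)
qed (auto simp: walk_mat_def)

text \<open>The destinations are a permutation, so sorting ends in a list without crossings, whose
  walk matrix is the identity.\<close>

lemma burau_bsort:
  assumes "lr xs" "mset (map fst xs) = mset [0..<length xs]"
  shows "burau (length xs) t (bsort (length xs) xs) = walk_mat t xs"
proof -
  have "\<exists>ys. mset ys = mset (xs @ []) \<and> sorted (map fst ys) \<and>
      walk_mat t (xs @ []) = burau (length xs) t (bsort (length xs) (xs @ [])) * walk_mat t ys"
    by (rule bsort_walk_mat) (simp_all add: assms(1))
  then obtain ys where ys: "mset ys = mset xs" "sorted (map fst ys)"
    "walk_mat t xs = burau (length xs) t (bsort (length xs) xs) * walk_mat t ys"
    unfolding append_Nil2 by blast
  have len: "length ys = length xs" using ys(1) by (rule mset_eq_length)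
  have "mset (map fst ys) = mset [0..<length xs]"
    using ys(1) assms(2) by (simp add: mset_map)
  then have "map fst ys = [0..<length ys]"
    using ys(2) len properties_for_sort[of "map fst ys" "[0..<length xs]"]
      properties_for_sort[of "[0..<length xs]" "[0..<length xs]"] by simp
  then show ?thesis
    using ys(3) walk_mat_sorted[of ys t] len right_mult_one_mat[OF burau_carrier] by simp
qed

section \<open>Eliminating the left points\<close>

text \<open>The matrix is \<open>?E * ?B\<close>, and \<open>?B * ?G\<close> has a zero upper right
  block by \<open>UF\<close>; both \<open>?E\<close> and \<open>?G\<close> have determinant 1.
  \<open>F\<close> stands in for a solution through the inverse of \<open>U\<close>, so the argument
  works over any integral domain.\<close>

lemma det_schur_elim:
  fixes U S Q W F :: "'a :: idom mat"
  assumes U: "U \<in> carrier_mat n n" and S: "S \<in> carrier_mat n q" and Q: "Q \<in> carrier_mat q n"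
    and W: "W \<in> carrier_mat n q" and F: "F \<in> carrier_mat n q" and UF: "U * F + W = 0\<^sub>m n q"
  shows "det (four_block_mat (U + S * Q) (W + S) Q (1\<^sub>m q)) = det U * det (Q * F + 1\<^sub>m q)"
proof -
  let ?B = "four_block_mat U W Q (1\<^sub>m q)"
  let ?E = "four_block_mat (1\<^sub>m n) S (0\<^sub>m q n) (1\<^sub>m q)"
  let ?G = "four_block_mat (1\<^sub>m n) F (0\<^sub>m q n) (1\<^sub>m q)"
  have carr: "?B \<in> carrier_mat (n + q) (n + q)" "?E \<in> carrier_mat (n + q) (n + q)"
    "?G \<in> carrier_mat (n + q) (n + q)"
    using U by auto
  have SQ: "S * Q \<in> carrier_mat n n" and QF: "Q * F \<in> carrier_mat q q" using S Q F by auto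
  have "?E * ?B = four_block_mat (1\<^sub>m n * U + S * Q) (1\<^sub>m n * W + S * 1\<^sub>m q)
      (0\<^sub>m q n * U + 1\<^sub>m q * Q) (0\<^sub>m q n * W + 1\<^sub>m q * 1\<^sub>m q)"
    by (rule mult_four_block_mat[OF one_carrier_mat S zero_carrier_mat one_carrier_mat U W Q one_carrier_mat])
  then have EB: "?E * ?B = four_block_mat (U + S * Q) (W + S) Q (1\<^sub>m q)"
    using U S Q W by simp
  have "?B * ?G = four_block_mat (U * 1\<^sub>m n + W * 0\<^sub>m q n) (U * F + W * 1\<^sub>m q)
      (Q * 1\<^sub>m n + 1\<^sub>m q * 0\<^sub>m q n) (Q * F + 1\<^sub>m q * 1\<^sub>m q)"
    by (rule mult_four_block_mat[OF U W Q one_carrier_mat one_carrier_mat F zero_carrier_mat one_carrier_mat])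
  then have BG: "?B * ?G = four_block_mat U (0\<^sub>m n q) Q (Q * F + 1\<^sub>m q)"
    using U Q W UF by simp
  have tri: "det (four_block_mat (1\<^sub>m n) X (0\<^sub>m q n) (1\<^sub>m q)) = (1 :: 'a)"
    if "X \<in> carrier_mat n q" for X
    by (subst det_four_block_mat_lower_left_zero[OF one_carrier_mat that refl one_carrier_mat]) simp
  have "det (?E * ?B) = det (?B * ?G)"
    by (simp add: det_mult[OF carr(2,1)] det_mult[OF carr(1,3)] tri[OF S] tri[OF F])
  also have "\<dots> = det U * det (Q * F + 1\<^sub>m q)"
    unfolding BG using QF by (intro det_four_block_mat_upper_right_zero[OF U refl Q]) auto
  finally show ?thesis unfolding EB .
qed

text \<open>The row of \<open>M\<close> at a left point \<open>p\<close> spreads the weights \<open>S p i\<close> over the images of the \<open>q\<close> right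
  points, and \<open>w p\<close> goes to \<open>f p\<close>. Following \<open>f\<close> from \<open>p\<close> until it leaves the left points
  accumulates the vector \<open>F p\<close>, which eliminates all left points from the determinant.\<close>
lemma det_minor_lorenz:
  fixes M :: "'a :: idom mat"
  assumes M: "M \<in> carrier_mat (Suc (n + q)) (Suc (n + q))"
    and left: "\<And>p. 1 \<le> p \<Longrightarrow> p \<le> n \<Longrightarrow> p < f p"
    and right: "\<And>i. i < q \<Longrightarrow> f (Suc n + i) \<le> n"
    and rec: "\<And>p i. 1 \<le> p \<Longrightarrow> p \<le> n \<Longrightarrow> i < q \<Longrightarrow>
      F p i = S p i + w p * (if f p \<le> n then F (f p) i else if f p = Suc n + i then 1 else 0)"
    and Mleft: "\<And>p c. 1 \<le> p \<Longrightarrow> p \<le> n \<Longrightarrow> c \<le> n + q \<Longrightarrow>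
      M $$ (p, c) = (\<Sum>i<q. S p i * (if f (Suc n + i) = c then 1 else 0)) + (if f p = c then w p else 0)"
    and Mright: "\<And>i c. i < q \<Longrightarrow> c \<le> n + q \<Longrightarrow> M $$ (Suc n + i, c) = (if f (Suc n + i) = c then 1 else 0)"
  shows "det (mat_delete (1\<^sub>m (Suc (n + q)) - M) 0 0) =
    det (mat q q (\<lambda>(i, j). (if i = j then 1 else 0) -
      (if f (Suc n + i) = 0 then 0 else F (f (Suc n + i)) j)))"
proof -
  \<comment> \<open>Point 0 is deleted, so row \<open>r\<close> belongs to the point
    \<open>Suc r\<close>: first the \<open>n\<close> left points, then the \<open>q\<close> right
    ones. Spreading weights over images of right points factors through \<open>Q\<close>.\<close>
  define U where "U = mat n n (\<lambda>(r, c). (if r = c then 1 else 0) - (if f (Suc r) = Suc c then w (Suc r) else 0))"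
  define S' where "S' = mat n q (\<lambda>(r, i). S (Suc r) i)"
  define Q :: "'a mat" where "Q = mat q n (\<lambda>(i, c). if f (Suc n + i) = Suc c then - 1 else 0)"
  define W where "W = mat n q (\<lambda>(r, i). - S (Suc r) i - (if f (Suc r) = Suc n + i then w (Suc r) else 0))"
  define F' where "F' = mat n q (\<lambda>(r, i). F (Suc r) i)"
  have carr: "U \<in> carrier_mat n n" "S' \<in> carrier_mat n q" "Q \<in> carrier_mat q n"
    "W \<in> carrier_mat n q" "F' \<in> carrier_mat n q"
    by (simp_all add: U_def S'_def Q_def W_def F'_def)
  have "U * F' + W = 0\<^sub>m n q"
  proof (rule eq_matI)
    fix r i assume "r < dim_row (0\<^sub>m n q)" "i < dim_col (0\<^sub>m n q)"
    then have ri: "r < n" "i < q" by auto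
    have "(U * F') $$ (r, i) = (\<Sum>c<n. (if r = c then F (Suc c) i else 0) -
        (if f (Suc r) = Suc c then w (Suc r) * F (Suc c) i else 0))"
      using ri by (auto simp: U_def F'_def scalar_prod_def lessThan_atLeast0 left_diff_distrib intro!: sum.cong)
    also have "\<dots> = F (Suc r) i - (\<Sum>c<n. if f (Suc r) = Suc c then w (Suc r) * F (Suc c) i else 0)"
      using ri by (simp add: sum_subtractf)
    also have "(\<Sum>c<n. if f (Suc r) = Suc c then w (Suc r) * F (Suc c) i else 0) =
        (if f (Suc r) \<le> n then w (Suc r) * F (f (Suc r)) i else 0)"
    proof (cases "f (Suc r)")
      case 0
      then show ?thesis using left[of "Suc r"] ri by simp
    next
      case (Suc d)
      then show ?thesis by auto
    qed
    finally show "(U * F' + W) $$ (r, i) = 0\<^sub>m n q $$ (r, i)"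
      using ri rec[of "Suc r" i] carr by (auto simp: W_def)
  qed (use carr in auto)
  then have "det (four_block_mat (U + S' * Q) (W + S') Q (1\<^sub>m q)) = det U * det (Q * F' + 1\<^sub>m q)"
    by (rule det_schur_elim[OF carr])
  moreover have "det U = 1"
  proof -
    \<comment> \<open>\<open>f\<close> moves every left point strictly up, hence \<open>U\<close> is
      unitriangular.\<close>
    have "f (Suc r) \<noteq> Suc c" if "r < n" "c < r" for r c using left[of "Suc r"] that by auto
    then have "upper_triangular U" by (auto simp: U_def)
    moreover have "f (Suc r) \<noteq> Suc r" if "r < n" for r using left[of "Suc r"] that by auto
    then have "diag_mat U = replicate n 1"
      by (auto simp: diag_mat_def U_def intro!: nth_equalityI)
    ultimately show ?thesis using det_upper_triangular carr(1) by (metis prod_list_replicate power_one)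
  qed
  moreover have "mat_delete (1\<^sub>m (Suc (n + q)) - M) 0 0 = four_block_mat (U + S' * Q) (W + S') Q (1\<^sub>m q)"
  proof (rule eq_matI)
    let ?A = "four_block_mat (U + S' * Q) (W + S') Q (1\<^sub>m q)"
    fix r c assume "r < dim_row ?A" "c < dim_col ?A"
    then have rc: "r < n + q" "c < n + q" using carr by auto
    have del: "mat_delete (1\<^sub>m (Suc (n + q)) - M) 0 0 $$ (r, c) = (if r = c then 1 else 0) - M $$ (Suc r, Suc c)"
      using rc M by (simp add: mat_delete_def)
    show "mat_delete (1\<^sub>m (Suc (n + q)) - M) 0 0 $$ (r, c) = ?A $$ (r, c)"
    proof (cases "r < n")
      case r: True
      then have row: "M $$ (Suc r, Suc c) =
        (\<Sum>i<q. S (Suc r) i * (if f (Suc n + i) = Suc c then 1 else 0)) + (if f (Suc r) = Suc c then w (Suc r) else 0)"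
        using rc by (intro Mleft) auto
      show ?thesis
      proof (cases "c < n")
        case True
        have "(S' * Q) $$ (r, c) = - (\<Sum>i<q. S (Suc r) i * (if f (Suc n + i) = Suc c then 1 else 0))"
          using r True by (auto simp: S'_def Q_def scalar_prod_def lessThan_atLeast0 sum_negf[symmetric] intro!: sum.cong)
        then show ?thesis using r True carr del row by (simp add: U_def)
      next
        case False
        then obtain d where d: "c = n + d" "d < q" using rc by (metis add_less_cancel_left le_Suc_ex not_le)
        \<comment> \<open>Images of right points are at most \<open>n\<close>, so they miss the
          columns of right points.\<close>
        have "(\<Sum>i<q. S (Suc r) i * (if f (Suc n + i) = Suc c then 1 else 0)) = 0"
          using right d by (intro sum.neutral) force
        then show ?thesis using r d carr del row by (simp add: W_def S'_def)
      qed
    next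
      case False
      then obtain i where i: "r = n + i" "i < q" using rc by (metis add_less_cancel_left le_Suc_ex not_le)
      have row: "M $$ (Suc n + i, Suc c) = (if f (Suc n + i) = Suc c then 1 else 0)"
        using i rc by (intro Mright) auto
      show ?thesis
      proof (cases "c < n")
        case True
        then show ?thesis using i carr del row by (simp add: Q_def)
      next
        case False
        then have "f (Suc n + i) \<noteq> Suc c" using right[of i] i by auto
        then show ?thesis using i rc False carr del row by auto
      qed
    qed
  qed (use carr M in \<open>auto simp: mat_delete_def\<close>)
  moreover have "Q * F' + 1\<^sub>m q = mat q q (\<lambda>(i, j). (if i = j then 1 else 0) -
      (if f (Suc n + i) = 0 then 0 else F (f (Suc n + i)) j))"
  proof (rule eq_matI)
    let ?B = "mat q q (\<lambda>(i, j). (if i = j then 1 else 0) -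
      (if f (Suc n + i) = 0 then 0 else F (f (Suc n + i)) j))"
    fix i j assume "i < dim_row ?B" "j < dim_col ?B"
    then have ij: "i < q" "j < q" by auto
    have "(Q * F') $$ (i, j) = (\<Sum>c<n. if f (Suc n + i) = Suc c then - F (Suc c) j else 0)"
      using ij by (auto simp: Q_def F'_def scalar_prod_def lessThan_atLeast0 intro!: sum.cong)
    also have "\<dots> = (if f (Suc n + i) = 0 then 0 else - F (f (Suc n + i)) j)"
    proof (cases "f (Suc n + i)")
      case (Suc d)
      then show ?thesis using right[of i] ij by simp
    qed auto
    finally show "(Q * F' + 1\<^sub>m q) $$ (i, j) = ?B $$ (i, j)"
      using ij carr by auto
  qed (use carr in auto)
  ultimately show ?thesis by simp
qed

section \<open>Coefficients of the Alexander polynomial\<close>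

text \<open>The value of the minor computed in \<open>det_minor_lorenz_map\<close>; its shape is that of
  \<open>det_bidiagonal_rank_one\<close>.\<close>
definition lorenz_alex :: "nat \<Rightarrow> 'a :: comm_ring_1 \<Rightarrow> 'a" where
  "lorenz_alex k t = (let X = t ^ (6 * k); G = (\<Sum>i<k. (t ^ 6) ^ i); g = (1 - t) * G;
     b = 1 - t * (1 - t) * (1 + t ^ 2 + t ^ 4) * G in
     b * (1 - g * (t ^ 2 + t ^ 3 * (1 + X) + t ^ 4 * (1 + X + X ^ 2) + t ^ 5 * (1 + X + X ^ 2 + X ^ 3)))
     - X * g * (t + t ^ 2 * X + t ^ 3 * X ^ 2 + t ^ 4 * X ^ 3 + t ^ 5 * X ^ 4))"

text \<open>Multiplying by \<open>(1 - t ^ 6)\<^sup>2\<close> clears both geometric sums; up to degree \<open>12 k\<close> only the first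
  two summands remain, so the coefficients grow linearly along residue classes modulo 6.\<close>
lemma lorenz_alex_mult:
  fixes t :: "'a :: comm_ring_1" and k :: nat
  defines "X \<equiv> t ^ (6 * k)" and "K \<equiv> (1 - t)\<^sup>2 * (1 + t ^ 2 + t ^ 4)"
  shows "lorenz_alex k t * (1 - t ^ 6) ^ 2 = (1 - t) * (1 - t ^ 6) + K * t ^ 2 * X +
    t * X ^ 2 * (K * (1 + t ^ 2) * (1 + t * X + t ^ 2 * X ^ 2) + K * t ^ 3 * X ^ 3
      + (1 - t) * (1 - t ^ 6) * t ^ 4 * X ^ 4)"
proof -
  define G where "G = (\<Sum>i<k. (t ^ 6) ^ i)"
  have G: "(1 - t ^ 6) * G = 1 - X"
    unfolding G_def X_def by (simp add: one_diff_power_eq power_mult)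
  define s where "s = t ^ 2 + t ^ 3 * (1 + X) + t ^ 4 * (1 + X + X ^ 2) + t ^ 5 * (1 + X + X ^ 2 + X ^ 3)"
  define v where "v = t + t ^ 2 * X + t ^ 3 * X ^ 2 + t ^ 4 * X ^ 3 + t ^ 5 * X ^ 4"
  define c where "c = t * (1 - t) * (1 + t ^ 2 + t ^ 4)"
  define q where "q = 1 - t ^ 6"
  \<comment> \<open>Each summand absorbs \<open>q ^ 2\<close> so that \<open>G\<close> occurs only
    in \<open>q * G\<close>, which is \<open>1 - X\<close>.\<close>
  have "((1 - c * G) * (1 - (1 - t) * G * s) - X * ((1 - t) * G) * v) * q ^ 2 =
      (q - c * (q * G)) * (q - (1 - t) * (q * G) * s) - X * ((1 - t) * (q * G)) * v * q"
    by (simp add: power2_eq_square algebra_simps)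
  then have "lorenz_alex k t * q ^ 2 =
      (q - c * (1 - X)) * (q - (1 - t) * (1 - X) * s) - X * ((1 - t) * (1 - X)) * v * q"
    unfolding lorenz_alex_def Let_def X_def[symmetric] G_def[symmetric] s_def[symmetric]
      v_def[symmetric] c_def[symmetric] G[folded q_def] .
  also have "\<dots> = (1 - t) * (1 - t ^ 6) + K * t ^ 2 * X +
    t * X ^ 2 * (K * (1 + t ^ 2) * (1 + t * X + t ^ 2 * X ^ 2) + K * t ^ 3 * X ^ 3
      + (1 - t) * (1 - t ^ 6) * t ^ 4 * X ^ 4)"
    unfolding K_def s_def v_def c_def q_def by (simp add: algebra_simps eval_nat_numeral)
  finally show ?thesis unfolding q_def .
qed

text \<open>Used to pass between the formula for integer polynomials, for power series and for
  values at numbers.\<close>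

lemma lorenz_alex_hom:
  assumes "h 1 = 1" "\<And>x y. h (x + y) = h x + h y" "\<And>x y. h (x - y) = h x - h y"
    "\<And>x y. h (x * y) = h x * h y"
  shows "h (lorenz_alex k t) = lorenz_alex k (h t)"
proof -
  have pow: "h (x ^ n) = h x ^ n" for x n by (induction n) (simp_all add: assms)
  have "h 0 = 0" using assms(3)[of 0 0] by simp
  then have "h (\<Sum>i<n. f i) = (\<Sum>i<n. h (f i))" for f :: "nat \<Rightarrow> _" and n
    by (induction n) (simp_all add: assms)
  with pow show ?thesis by (simp add: lorenz_alex_def Let_def assms)
qed

lemma poly_lorenz_alex:
  "poly (map_poly real_of_int (lorenz_alex k [:0, 1:])) t = lorenz_alex k t"
proof -
  let ?m = "map_poly real_of_int"
  have "?m (x + y) = ?m x + ?m y" "?m (x - y) = ?m x - ?m y" "?m (x * y) = ?m x * ?m y" for x y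
    by (simp_all add: poly_eq_iff coeff_map_poly coeff_mult)
  then have "poly (?m (lorenz_alex k [:0, 1:])) t = lorenz_alex k (poly (?m [:0, 1:]) t)"
    by (intro lorenz_alex_hom[where h = "\<lambda>p. poly (?m p) t"]) simp_all
  then show ?thesis by (simp add: map_poly_pCons)
qed

lemma poly_int_lorenz_alex: "poly (lorenz_alex k [:0, 1:]) t = lorenz_alex k (t :: int)"
  by (subst lorenz_alex_hom[where h = "\<lambda>p. poly p t"]) simp_all

lemma lorenz_alex_1: "lorenz_alex k (1 :: int) = 1"
  by (simp add: lorenz_alex_def Let_def)

lemma coeff_0_lorenz_alex: "1 \<le> k \<Longrightarrow> coeff (lorenz_alex k [:0, 1:]) 0 = (1 :: int)"
  unfolding poly_0_coeff_0[symmetric] poly_int_lorenz_alex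
  by (cases k) (simp_all add: lorenz_alex_def Let_def sum.lessThan_Suc_shift)

text \<open>The coefficients of \<open>1 / (1 - X ^ 6)\<^sup>2\<close>.\<close>
definition inv_sq_coeff :: "nat \<Rightarrow> int" where
  "inv_sq_coeff n = (if 6 dvd n then int (n div 6) + 1 else 0)"

text \<open>The factor \<open>1 - 2 X ^ 6 + X ^ 12\<close> takes second differences along multiples
  of 6, which vanish on a linear sequence past its start.\<close>

lemma fps_inv_sq: "(1 - fps_X ^ 6) ^ 2 * Abs_fps inv_sq_coeff = 1"
proof (rule fps_ext)
  fix n
  have "(1 - fps_X ^ 6) ^ 2 * Abs_fps inv_sq_coeff = Abs_fps inv_sq_coeff
      - fps_const 2 * (fps_X ^ 6 * Abs_fps inv_sq_coeff) + fps_X ^ 12 * Abs_fps inv_sq_coeff"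
    by (simp add: power2_eq_square algebra_simps flip: power_add numeral_fps_const)
  then have "fps_nth ((1 - fps_X ^ 6) ^ 2 * Abs_fps inv_sq_coeff) n = inv_sq_coeff n
      - 2 * (if n < 6 then 0 else inv_sq_coeff (n - 6)) + (if n < 12 then 0 else inv_sq_coeff (n - 12))"
    by (simp add: fps_X_power_mult_nth)
  also have "\<dots> = (if n = 0 then 1 else 0)"
  proof -
    consider "n < 6" | m where "n = m + 6" "m < 6" | m where "n = m + 12"
    proof -
      have "n < 6 \<or> n = (n - 6) + 6 \<and> n - 6 < 6 \<or> n = (n - 12) + 12" by linarith
      then show thesis using that by blast
    qed
    then show ?thesis
    proof cases
      case 1
      then show ?thesis by (auto simp: inv_sq_coeff_def dest: dvd_imp_le)
    next
      case 2
      then show ?thesis by (auto simp: inv_sq_coeff_def dest: dvd_imp_le)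
    next
      case 3
      have "6 dvd m + 12 \<longleftrightarrow> 6 dvd m" "6 dvd m + 6 \<longleftrightarrow> 6 dvd m" "(m + 12) div 6 = m div 6 + 2" by presburger+
      with 3 show ?thesis by (auto simp: inv_sq_coeff_def)
    qed
  qed
  finally show "fps_nth ((1 - fps_X ^ 6) ^ 2 * Abs_fps inv_sq_coeff) n = fps_nth (1 :: int fps) n" by simp
qed

definition shifted :: "nat \<Rightarrow> nat \<Rightarrow> int" where
  "shifted a d = (if d < a then 0 else inv_sq_coeff (d - a))"

lemma shifted_mod_6:
  assumes "r < 6" "s < 6"
  shows "shifted (6 * a + r) (6 * b + s) = (if r = s \<and> a \<le> b then int b - int a + 1 else 0)"
proof (cases "r = s")
  case True
  show ?thesis
  proof (cases "a \<le> b")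
    case le: True
    then have "6 * b + s - (6 * a + r) = 6 * (b - a)" using True by simp
    then show ?thesis using True le by (simp add: shifted_def inv_sq_coeff_def of_nat_diff)
  qed (use True in \<open>auto simp: shifted_def\<close>)
next
  case False
  have "\<not> 6 dvd (6 * b + s - (6 * a + r))" if "6 * a + r \<le> 6 * b + s"
    using that False assms by (simp flip: mod_eq_dvd_iff_nat)
  then show ?thesis using False by (auto simp: shifted_def inv_sq_coeff_def)
qed

lemma nth_X_power_inv_sq:
  "fps_nth (fps_X ^ a * Abs_fps inv_sq_coeff) d = shifted a d"
  by (simp add: fps_X_power_mult_nth shifted_def)

text \<open>Each shift is a monomial of the numerator in \<open>lorenz_alex_mult\<close>, divided by
  \<open>(1 - t ^ 6)\<^sup>2\<close>; the rest is divisible by \<open>t ^ (12 * k + 1)\<close>,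
  whence the bound on \<open>d\<close>.\<close>

lemma coeff_lorenz_alex:
  fixes k d :: nat
  assumes "d \<le> 12 * k"
  shows "coeff (lorenz_alex k [:0, 1:]) d = shifted 0 d - shifted 1 d - shifted 6 d + shifted 7 d
    + shifted (6 * k + 2) d - 2 * shifted (6 * k + 3) d + 2 * shifted (6 * k + 4) d
    - 2 * shifted (6 * k + 5) d + 2 * shifted (6 * k + 6) d - 2 * shifted (6 * k + 7) d
    + shifted (6 * k + 8) d"
proof -
  let ?E = "Abs_fps inv_sq_coeff" and ?T = "fps_X :: int fps"
  obtain R where R: "lorenz_alex k ?T * (1 - ?T ^ 6) ^ 2 =
      (1 - ?T) * (1 - ?T ^ 6) + (1 - ?T)\<^sup>2 * (1 + ?T ^ 2 + ?T ^ 4) * ?T ^ 2 * ?T ^ (6 * k)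
      + ?T * (?T ^ (6 * k)) ^ 2 * R"
    using lorenz_alex_mult by blast
  have "fps_of_poly (lorenz_alex k [:0, 1:]) = lorenz_alex k (fps_of_poly [:0, 1 :: int:])"
    by (intro lorenz_alex_hom[where h = fps_of_poly])
      (simp_all add: fps_of_poly_add fps_of_poly_diff fps_of_poly_mult)
  then have "fps_of_poly (lorenz_alex k [:0, 1:]) = lorenz_alex k ?T * (1 - ?T ^ 6) ^ 2 * ?E"
    using fps_inv_sq by (simp add: fps_of_poly_pCons mult.assoc)
  also have "\<dots> = ?T ^ 0 * ?E - ?T ^ 1 * ?E - ?T ^ 6 * ?E + ?T ^ 7 * ?E
      + ?T ^ (6 * k + 2) * ?E - fps_const 2 * (?T ^ (6 * k + 3) * ?E) + fps_const 2 * (?T ^ (6 * k + 4) * ?E)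
      - fps_const 2 * (?T ^ (6 * k + 5) * ?E) + fps_const 2 * (?T ^ (6 * k + 6) * ?E)
      - fps_const 2 * (?T ^ (6 * k + 7) * ?E) + ?T ^ (6 * k + 8) * ?E + ?T ^ (12 * k + 1) * (R * ?E)"
  proof -
    have X2: "?T * (?T ^ (6 * k)) ^ 2 = ?T ^ (12 * k + 1)"
      by (simp flip: power_mult)
    show ?thesis unfolding R X2
      by (simp add: algebra_simps eval_nat_numeral flip: numeral_fps_const)
  qed
  finally have eq: "fps_of_poly (lorenz_alex k [:0, 1:]) = ?T ^ 0 * ?E - ?T ^ 1 * ?E - ?T ^ 6 * ?E + ?T ^ 7 * ?E
      + ?T ^ (6 * k + 2) * ?E - fps_const 2 * (?T ^ (6 * k + 3) * ?E) + fps_const 2 * (?T ^ (6 * k + 4) * ?E)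
      - fps_const 2 * (?T ^ (6 * k + 5) * ?E) + fps_const 2 * (?T ^ (6 * k + 6) * ?E)
      - fps_const 2 * (?T ^ (6 * k + 7) * ?E) + ?T ^ (6 * k + 8) * ?E + ?T ^ (12 * k + 1) * (R * ?E)" .
  have "fps_nth (?T ^ (12 * k + 1) * (R * ?E)) d = 0"
    unfolding fps_X_power_mult_nth using assms by simp
  then have "fps_nth (fps_of_poly (lorenz_alex k [:0, 1:])) d = shifted 0 d - shifted 1 d - shifted 6 d + shifted 7 d
    + shifted (6 * k + 2) d - 2 * shifted (6 * k + 3) d + 2 * shifted (6 * k + 4) d
    - 2 * shifted (6 * k + 5) d + 2 * shifted (6 * k + 6) d - 2 * shifted (6 * k + 7) d
    + shifted (6 * k + 8) d"
    unfolding eq fps_add_nth fps_sub_nth fps_mult_left_const_nth nth_X_power_inv_sq by simp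
  then show ?thesis by simp
qed

lemma coeff_lorenz_alex_mod_6:
  assumes "6 * b + s \<le> 12 * k" "s < 6"
  shows "coeff (lorenz_alex k [:0, 1:]) (6 * b + s) =
    (let e = \<lambda>a r. if r = s \<and> a \<le> b then int b - int a + 1 else 0 in
      e 0 0 - e 0 1 - e 1 0 + e 1 1 + e k 2 - 2 * e k 3 + 2 * e k 4 - 2 * e k 5
      + 2 * e (k + 1) 0 - 2 * e (k + 1) 1 + e (k + 1) 2)"
proof -
  have block: "6 * k + 6 = 6 * (k + 1) + 0"
    "6 * k + 7 = 6 * (k + 1) + 1" "6 * k + 8 = 6 * (k + 1) + 2" by simp_all
  have "shifted 6 d = shifted (6 * 1 + 0) d" "shifted 7 d = shifted (6 * 1 + 1) d"
    "shifted 0 d = shifted (6 * 0 + 0) d" "shifted 1 d = shifted (6 * 0 + 1) d" for d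
    by simp_all
  then show ?thesis
    unfolding coeff_lorenz_alex[OF assms(1)] block Let_def
    by (simp only: shifted_mod_6 assms(2))
qed

text \<open>In the range of linear growth the residues 2, 4, 3 and 1 modulo 6 give the positive odd,
  positive even, negative even and, from -3 downwards, negative odd numbers.\<close>

lemma ex_coeff_lorenz_alex:
  fixes c :: int
  shows "\<exists>k \<ge> 1. \<exists>d \<le> degree (lorenz_alex k [:0, 1 :: int:]). coeff (lorenz_alex k [:0, 1:]) d = c"
proof -
  have ex: ?thesis if "1 \<le> k" "coeff (lorenz_alex k [:0, 1:]) d = c" "c \<noteq> 0" for k d
    using that by (metis le_degree)
  consider "c = 0" | "c = -1" | i where "c = 2 * int i + 1" | i where "c = 2 * int i + 2"
    | i where "c = - 2 * int i - 2" | i where "c = - 2 * int i - 3"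
  proof -
    show thesis
    proof (cases "even c")
      case True
      then obtain b where "c = 2 * b" by (rule evenE)
      then show ?thesis using that(1) that(4)[of "nat (b - 1)"] that(5)[of "nat (- b - 1)"] by linarith
    next
      case False
      then obtain b where "c = 2 * b + 1" by (rule oddE)
      then show ?thesis using that(2) that(3)[of "nat b"] that(6)[of "nat (- b - 2)"] by linarith
    qed
  qed
  then show ?thesis
  proof cases
    case 1
    \<comment> \<open>A zero coefficient does not bound the degree, so a nonzero one of higher
      degree is exhibited.\<close>
    have "coeff (lorenz_alex 1 [:0, 1 :: int:]) 8 = 1"
      using coeff_lorenz_alex_mod_6[of 1 2 1] by simp
    then have "2 \<le> degree (lorenz_alex 1 [:0, 1 :: int:])"
      using le_degree[of "lorenz_alex 1 [:0, 1 :: int:]" 8] by simp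
    moreover have "coeff (lorenz_alex 1 [:0, 1 :: int:]) 2 = 0"
      using coeff_lorenz_alex_mod_6[of 0 2 1] by (simp add: numeral_2_eq_2)
    ultimately show ?thesis using 1 by blast
  next
    case 2
    then show ?thesis using coeff_lorenz_alex_mod_6[of 0 1 1] by (intro ex[of 1 1]) simp_all
  next
    case (3 i)
    then show ?thesis using coeff_lorenz_alex_mod_6[of "i + 1 + i" 2 "i + 1"]
      by (intro ex[of "i + 1" "6 * (i + 1 + i) + 2"]) simp_all
  next
    case (4 i)
    then show ?thesis using coeff_lorenz_alex_mod_6[of "i + 1 + i" 4 "i + 1"]
      by (intro ex[of "i + 1" "6 * (i + 1 + i) + 4"]) simp_all
  next
    case (5 i)
    then show ?thesis using coeff_lorenz_alex_mod_6[of "i + 1 + i" 3 "i + 1"]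
      by (intro ex[of "i + 1" "6 * (i + 1 + i) + 3"]) simp_all
  next
    case (6 i)
    then show ?thesis using coeff_lorenz_alex_mod_6[of "i + 2 + 1 + i" 1 "i + 2"]
      by (intro ex[of "i + 2" "6 * (i + 2 + 1 + i) + 1"]) simp_all
  qed
qed

section \<open>The family of knots\<close>

context lorenz_cycle
begin

text \<open>\<open>f\<close> increases on each side, so only a left and a right strand can be
  inverted.\<close>

lemma lr_strands: "lr (strands word)"
proof -
  have lr_iff: "lr xs \<longleftrightarrow> sorted_wrt (\<lambda>x y. fst y < fst x \<longrightarrow> snd x \<and> \<not> snd y) xs" for xs
    by (induction xs) auto
  have "i < l \<and> \<not> j < l" if "i < j" "j < m" "f j < f i" for i j
    using that mono_left[of i j] mono_right[of i j] by force
  then show ?thesis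
    unfolding lr_iff strands_word sorted_wrt_map
    by (auto simp: sorted_wrt_iff_nth_less)
qed

lemma burau_word: "burau m t (modular_braid word) = walk_mat t (strands word)"
proof -
  have "f ` {..<m} = {..<m}"
    by (rule endo_inj_surj) (auto simp: maps_to inj)
  then have "mset (map fst (strands word)) = mset [0..<length (strands word)]"
    using inj by (simp add: strands_word comp_def mset_map[symmetric] del: mset_map)
      (simp add: image_mset_mset_set lessThan_atLeast0)
  from burau_bsort[OF lr_strands this, of t] show ?thesis
    by (simp add: modular_braid_def length_word strands_word)
qed

end

text \<open>In the notation of Birman and Kofman this is the Lorenz knot \<open>T((2, 6k), (6, 6k + 1))\<close>:
  \<open>6k\<close> left strands cross two right strands each, the other \<open>6k + 1\<close> cross all six.\<close>
definition lorenz_map :: "nat \<Rightarrow> nat \<Rightarrow> nat" where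
  "lorenz_map k p = (if p < 6 * k then p + 2 else if p < 12 * k + 1 then p + 6
     else if p < 12 * k + 3 then p - (12 * k + 1) else p - (6 * k + 1))"

text \<open>Low points climb by 2 and high ones by 6. From 0 the orbit climbs to \<open>6k\<close>
  and on to \<open>12k + 6\<close>, falls to \<open>6k + 5\<close>, and descends through the
  residues 5, 4, 3, 2 with a climb at each; then it falls to 1 and climbs to
  \<open>6k + 1\<close>.\<close>

lemma lorenz_map_transitive:
  assumes "p < 12 * k + 7"
  shows "\<exists>j. p = (lorenz_map k ^^ j) 0"
proof -
  define reach where "reach p \<longleftrightarrow> (\<exists>j. p = (lorenz_map k ^^ j) 0)" for p
  have step: "reach (lorenz_map k p)" if r: "reach p" for p
  proof -
    obtain j where "p = (lorenz_map k ^^ j) 0" using r unfolding reach_def by blast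
    then have "lorenz_map k p = (lorenz_map k ^^ Suc j) 0" by simp
    then show ?thesis unfolding reach_def by blast
  qed
  have low: "reach (r + 2 * i)" if "reach r" "r + 2 * i \<le> 6 * k + 1" for r i
    using that(2)
  proof (induction i)
    case (Suc i)
    then show ?case using step[of "r + 2 * i"] by (simp add: lorenz_map_def ac_simps)
  qed (use that in simp)
  have high: "reach (6 * k + r + 6 * i)" if "reach (6 * k + r)" "r + 6 * i \<le> 6 * k + 6" for r i
    using that(2)
  proof (induction i)
    case (Suc i)
    then show ?case using step[of "6 * k + r + 6 * i"] by (simp add: lorenz_map_def ac_simps)
  qed (use that in simp)
  have "(lorenz_map k ^^ 0) 0 = 0" by simp
  then have r0: "reach 0" unfolding reach_def by metis
  have h0: "reach (6 * k + 0)" using low[OF r0, of "3 * k"] by simp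
  have h5: "reach (6 * k + 5)" using step[OF high[OF h0, of "k + 1"]] by (simp add: lorenz_map_def ac_simps)
  have h4: "reach (6 * k + 4)" using step[OF high[OF h5, of k]] by (simp add: lorenz_map_def ac_simps)
  have h3: "reach (6 * k + 3)" using step[OF high[OF h4, of k]] by (simp add: lorenz_map_def ac_simps)
  have h2: "reach (6 * k + 2)" using step[OF high[OF h3, of k]] by (simp add: lorenz_map_def ac_simps)
  have r1: "reach 1" using step[OF high[OF h2, of k]] by (simp add: lorenz_map_def ac_simps)
  have h1: "reach (6 * k + 1)" using low[OF r1, of "3 * k"] by (simp add: ac_simps)
  have "reach p"
  proof (cases "p < 6 * k")
    case True
    have "p = 0 + 2 * (p div 2) \<or> p = 1 + 2 * (p div 2)" by presburger
    then show ?thesis using low[OF r0, of "p div 2"] low[OF r1, of "p div 2"] True by auto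
  next
    case False
    define r i where "r = (p - 6 * k) mod 6" and "i = (p - 6 * k) div 6"
    have p: "p = 6 * k + r + 6 * i" using False by (simp add: r_def i_def)
    have "r < 6" by (simp add: r_def)
    then have "r = 0 \<or> r = 1 \<or> r = 2 \<or> r = 3 \<or> r = 4 \<or> r = 5" by linarith
    then have "reach (6 * k + r)" using h0 h1 h2 h3 h4 h5 by (elim disjE) simp_all
    moreover have "r + 6 * i \<le> 6 * k + 6" using assms p by simp
    ultimately show ?thesis unfolding p by (rule high)
  qed
  then show ?thesis by (simp add: reach_def)
qed

lemma lorenz_cycle_lorenz_map:
  assumes "1 \<le> k"
  shows "lorenz_cycle (12 * k + 7) (12 * k + 1) (lorenz_map k)"
proof
  show "inj_on (lorenz_map k) {..<12 * k + 7}"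
    by (rule inj_onI) (auto simp: lorenz_map_def split: if_splits)
qed (use assms lorenz_map_transitive in \<open>auto simp: lorenz_map_def\<close>)

section \<open>Accumulated weights along the orbits of the family\<close>

lemma walk_skip:
  "(\<And>x. x \<in> set us \<Longrightarrow> \<not> fst x < d) \<Longrightarrow> walk t d (us @ vs) c = walk t d vs c"
  by (induction us) auto

text \<open>The vector \<open>F\<close> of \<open>det_minor_lorenz\<close> for
  \<open>lorenz_map\<close>: the total weight with which a walk from \<open>p\<close> falls onto the
  strand of right point \<open>i\<close> or arrives at that point.\<close>

function path_weight :: "nat \<Rightarrow> 'a :: comm_ring_1 \<Rightarrow> nat \<Rightarrow> nat \<Rightarrow> 'a" where
  "path_weight k t p i =
    (if 12 * k < p then if p = 12 * k + 1 + i then 1 else 0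
     else (if i < (if p < 6 * k then 2 else 6) then (1 - t) * t ^ i else 0)
       + (if p < 6 * k then t ^ 2 else t ^ 6) * path_weight k t (lorenz_map k p) i)"
  by pat_completeness auto
termination
  by (relation "measure (\<lambda>(k, t, p, i). 12 * k + 1 - p)") (auto simp: lorenz_map_def)

declare path_weight.simps [simp del]

lemma path_weight_high:
  assumes "6 * k \<le> p" "p + 6 * n \<le> 12 * k + 6" "i < 6"
  shows "path_weight k t p i = (1 - t) * t ^ i * (\<Sum>j<n. (t ^ 6) ^ j) + (t ^ 6) ^ n * path_weight k t (p + 6 * n) i"
  using assms(2)
proof (induction n)
  case (Suc n)
  have "path_weight k t (p + 6 * n) i = (1 - t) * t ^ i + t ^ 6 * path_weight k t (p + 6 * Suc n) i"
    using Suc.prems assms(1,3) by (subst path_weight.simps) (simp add: lorenz_map_def ac_simps)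
  then have "path_weight k t p i = (1 - t) * t ^ i * (\<Sum>j<n. (t ^ 6) ^ j)
      + (t ^ 6) ^ n * ((1 - t) * t ^ i + t ^ 6 * path_weight k t (p + 6 * Suc n) i)"
    using Suc by simp
  then show ?case by (simp only: sum.lessThan_Suc power_Suc ring_distribs ac_simps)
qed simp

lemma path_weight_low:
  assumes "p + 2 * n \<le> 6 * k + 1"
  shows "path_weight k t p i = (if i < 2 then (1 - t) * t ^ i else 0) * (\<Sum>j<n. (t ^ 2) ^ j)
    + (t ^ 2) ^ n * path_weight k t (p + 2 * n) i"
  using assms
proof (induction n)
  case (Suc n)
  have "path_weight k t (p + 2 * n) i = (if i < 2 then (1 - t) * t ^ i else 0) + t ^ 2 * path_weight k t (p + 2 * Suc n) i"
    using Suc.prems by (subst path_weight.simps) (simp add: lorenz_map_def)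
  with Suc show ?case by (simp add: algebra_simps)
qed simp

text \<open>After \<open>k\<close> steps of size 6 the walk is at \<open>12k + r\<close>, the right
  point of index \<open>r - 1\<close>.\<close>

lemma path_weight_entry:
  assumes "r \<le> 6" "1 \<le> r" "i < 6"
  shows "path_weight k t (6 * k + r) i = (1 - t) * t ^ i * (\<Sum>j<k. (t ^ 6) ^ j) + t ^ (6 * k) * (if r = Suc i then 1 else 0)"
proof -
  have "path_weight k t (6 * k + r + 6 * k) i = (if r = Suc i then 1 else 0)"
    using assms by (subst path_weight.simps) auto
  then show ?thesis
    using path_weight_high[of k "6 * k + r" k i t] assms by (simp add: power_mult)
qed

text \<open>The walk makes \<open>3k\<close> steps of size 2 to \<open>6k + 1\<close>, then
  \<open>k\<close> steps of size 6 to the first right point. Grouping the low steps by threes turns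
  their sum into one in powers of \<open>t ^ 6\<close>.\<close>

lemma path_weight_1:
  assumes "i < 6"
  shows "path_weight k t 1 i = (if i < 2 then (1 - t) * t ^ i else 0) * ((1 + t ^ 2 + t ^ 4) * (\<Sum>j<k. (t ^ 6) ^ j))
    + t ^ (6 * k) * ((1 - t) * t ^ i * (\<Sum>j<k. (t ^ 6) ^ j) + t ^ (6 * k) * (if i = 0 then 1 else 0))"
proof -
  have "(\<Sum>j<3 * k. (t ^ 2) ^ j) = (1 + t ^ 2 + t ^ 4) * (\<Sum>j<k. (t ^ 6) ^ j)"
  proof (induction k)
    case (Suc k)
    have Y: "(t ^ 2) ^ (3 * k) = (t ^ 6) ^ k" by (simp flip: power_mult)
    have "3 * Suc k = Suc (Suc (Suc (3 * k)))" by simp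
    then have "(\<Sum>j<3 * Suc k. (t ^ 2) ^ j) = (\<Sum>j<3 * k. (t ^ 2) ^ j) + (t ^ 6) ^ k
        + t ^ 2 * (t ^ 6) ^ k + t ^ 2 * (t ^ 2 * (t ^ 6) ^ k)"
      by (simp only: sum.lessThan_Suc power_Suc Y)
    moreover have "t ^ 2 * (t ^ 2 * (t ^ 6) ^ k) = t ^ 4 * (t ^ 6) ^ k"
      by (simp add: mult.assoc[symmetric] flip: power_add)
    ultimately show ?case using Suc by (simp add: ring_distribs)
  qed simp
  moreover have "(t ^ 2) ^ (3 * k) = t ^ (6 * k)" by (simp flip: power_mult)
  ultimately show ?thesis
    using path_weight_low[of 1 "3 * k" k t i] path_weight_entry[of 1 i k t] assms by (simp add: add.commute)
qed

section \<open>Small determinants by Laplace expansion\<close>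

lemma det_mat_Suc:
  "det (mat (Suc n) (Suc n) g) = (\<Sum>j<Suc n. g (0, j) * ((- 1) ^ j *
     det (mat n n (\<lambda>(i, c). g (Suc i, if c < j then c else Suc c)))))"
proof -
  have "mat_delete (mat (Suc n) (Suc n) g) 0 j = mat n n (\<lambda>(i, c). g (Suc i, if c < j then c else Suc c))"
    if "j < Suc n" for j
    using that by (auto simp: mat_delete_def intro!: eq_matI)
  then show ?thesis
    by (subst laplace_expansion_row[of _ "Suc n" 0]) (auto simp: cofactor_def)
qed

lemma det_mat_2: "det (mat 2 2 g) = g (0, 0) * g (1, 1) - g (0, 1) * g (1, 0)"
  using det_mat_Suc[of 1 g] by (simp add: numeral_2_eq_2 det_mat_Suc)

lemma det_mat_3: "det (mat 3 3 g) = g (0, 0) * (g (1, 1) * g (2, 2) - g (1, 2) * g (2, 1))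
    - g (0, 1) * (g (1, 0) * g (2, 2) - g (1, 2) * g (2, 0))
    + g (0, 2) * (g (1, 0) * g (2, 1) - g (1, 1) * g (2, 0))"
  using det_mat_Suc[of 2 g] by (simp add: det_mat_2[unfolded numeral_2_eq_2] numeral_eq_Suc algebra_simps)

lemma det_mat_4: "det (mat 4 4 g) =
    g (0, 0) * det (mat 3 3 (\<lambda>(i, c). g (Suc i, Suc c)))
    - g (0, 1) * det (mat 3 3 (\<lambda>(i, c). g (Suc i, if c < 1 then c else Suc c)))
    + g (0, 2) * det (mat 3 3 (\<lambda>(i, c). g (Suc i, if c < 2 then c else Suc c)))
    - g (0, 3) * det (mat 3 3 (\<lambda>(i, c). g (Suc i, if c < 3 then c else Suc c)))"
  using det_mat_Suc[of 3 g] by (simp add: eval_nat_numeral)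

lemma det_mat_5: "det (mat 5 5 g) =
    g (0, 0) * det (mat 4 4 (\<lambda>(i, c). g (Suc i, Suc c)))
    - g (0, 1) * det (mat 4 4 (\<lambda>(i, c). g (Suc i, if c < 1 then c else Suc c)))
    + g (0, 2) * det (mat 4 4 (\<lambda>(i, c). g (Suc i, if c < 2 then c else Suc c)))
    - g (0, 3) * det (mat 4 4 (\<lambda>(i, c). g (Suc i, if c < 3 then c else Suc c)))
    + g (0, 4) * det (mat 4 4 (\<lambda>(i, c). g (Suc i, if c < 4 then c else Suc c)))"
  using det_mat_Suc[of 4 g] by (simp add: eval_nat_numeral)

text \<open>An instance of the matrix determinant lemma: the factors of the \<open>a j\<close> form
  the adjugate of the bidiagonal part applied to \<open>(u, v, v, v, v)\<close>.\<close>

lemma det_bidiagonal_rank_one: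
  fixes b x u v :: "'a :: comm_ring_1"
  shows "det (mat 5 5 (\<lambda>(i, j). (if i = j then if i = 0 then b else 1 else if i = Suc j then - x else 0)
      - (if i = 0 then u else v) * a j)) =
    b - (u * a 0 + (b * v + x * u) * a 1 + (b * v * (1 + x) + x ^ 2 * u) * a 2
      + (b * v * (1 + x + x ^ 2) + x ^ 3 * u) * a 3 + (b * v * (1 + x + x ^ 2 + x ^ 3) + x ^ 4 * u) * a 4)"
  by (simp add: det_mat_5 det_mat_4 det_mat_3) (simp add: algebra_simps eval_nat_numeral)

text \<open>A left strand passes over right strands in their order: the first two if
  \<open>p < 6 * k\<close>, all six otherwise. A right strand passes over none.\<close>

lemma walk_mat_lorenz_map:
  assumes "1 \<le> k" "p < 12 * k + 7" "c < 12 * k + 7"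
  shows "walk_mat t (map (\<lambda>p. (lorenz_map k p, p < 12 * k + 1)) [0..<12 * k + 7]) $$ (p, c) =
    (if p < 12 * k + 1 then
       (\<Sum>i<6. (if i < (if p < 6 * k then 2 else 6) then (1 - t) * t ^ i else 0)
         * (if lorenz_map k (12 * k + 1 + i) = c then 1 else 0))
       + (if lorenz_map k p = c then if p < 6 * k then t ^ 2 else t ^ 6 else 0)
     else if lorenz_map k p = c then 1 else 0)"
proof -
  interpret lorenz_cycle "12 * k + 7" "12 * k + 1" "lorenz_map k"
    using assms(1) by (rule lorenz_cycle_lorenz_map)
  let ?s = "\<lambda>p. (lorenz_map k p, p < 12 * k + 1)"
  have entry: "walk_mat t (map ?s [0..<12 * k + 7]) $$ (p, c) =
      walk t (lorenz_map k p) (map ?s [Suc p..<12 * k + 7]) c"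
    using assms(2,3) by (simp add: walk_mat_def drop_map)
  show ?thesis
  proof (cases "p < 12 * k + 1")
    case True
    have split: "[Suc p..<12 * k + 7] = [Suc p..<12 * k + 1] @ [12 * k + 1..<12 * k + 7]"
    proof -
      have "12 * k + 7 = 12 * k + 1 + 6" by simp
      then show ?thesis using True upt_add_eq_append[of "Suc p" "12 * k + 1" 6] by (simp only: Suc_leI)
    qed
    have right: "map ?s [12 * k + 1..<12 * k + 7] = [(0, False), (1, False), (6 * k + 2, False),
        (6 * k + 3, False), (6 * k + 4, False), (6 * k + 5, False)]"
      using assms(1) by (simp add: upt_conv_Cons lorenz_map_def)
    have "\<not> fst x < lorenz_map k p" if x: "x \<in> set (map ?s [Suc p..<12 * k + 1])" for x
    proof -
      obtain q where "q \<in> {Suc p..<12 * k + 1}" "x = ?s q" using x unfolding set_map set_upt by blast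
      then show ?thesis using mono_left[of p q] by simp
    qed
    then have "walk t (lorenz_map k p) (map ?s [Suc p..<12 * k + 7]) c =
        walk t (lorenz_map k p) (map ?s [12 * k + 1..<12 * k + 7]) c"
      unfolding split map_append by (intro walk_skip)
    then have row: "walk_mat t (map ?s [0..<12 * k + 7]) $$ (p, c) = walk t (lorenz_map k p)
        [(0, False), (1, False), (6 * k + 2, False), (6 * k + 3, False), (6 * k + 4, False), (6 * k + 5, False)] c"
      unfolding entry right .
    define \<delta> :: "nat \<Rightarrow> real" where "\<delta> x = (if c = x then 1 else 0)" for x
    have delta: "(if c = x then 1 else 0) = \<delta> x" "(if x = c then 1 else 0) = \<delta> x"
      "(if x = c then y else 0) = y * \<delta> x" for x y by (simp_all add: \<delta>_def)
    have image: "lorenz_map k (12 * k + 1 + 0) = 0" "lorenz_map k (12 * k + 1 + 1) = 1"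
      "lorenz_map k (12 * k + 1 + 2) = 6 * k + 2" "lorenz_map k (12 * k + 1 + 3) = 6 * k + 3"
      "lorenz_map k (12 * k + 1 + 4) = 6 * k + 4" "lorenz_map k (12 * k + 1 + 5) = 6 * k + 5"
      by (simp_all add: lorenz_map_def)
    have sum: "(\<Sum>i<6. h i) = h 0 + h 1 + h 2 + h 3 + h 4 + h 5" for h :: "nat \<Rightarrow> real"
      by (simp add: eval_nat_numeral)
    show ?thesis
    proof (cases "p < 6 * k")
      case low: True
      then have d: "lorenz_map k p = p + 2" by (simp add: lorenz_map_def)
      have "walk t (p + 2) [(0, False), (1, False), (6 * k + 2, False), (6 * k + 3, False), (6 * k + 4, False), (6 * k + 5, False)] c
          = (1 - t) * \<delta> 0 + t * ((1 - t) * \<delta> 1 + t * \<delta> (p + 2))"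
        unfolding walk.simps delta using low by simp
      then show ?thesis
        unfolding row sum image d delta using low True by (simp add: power2_eq_square distrib_left)
    next
      case high: False
      then have d: "lorenz_map k p = p + 6" using True by (simp add: lorenz_map_def)
      have "walk t (p + 6) [(0, False), (1, False), (6 * k + 2, False), (6 * k + 3, False), (6 * k + 4, False), (6 * k + 5, False)] c
          = (1 - t) * \<delta> 0 + t * ((1 - t) * \<delta> 1 + t * ((1 - t) * \<delta> (6 * k + 2) + t * ((1 - t) * \<delta> (6 * k + 3)
            + t * ((1 - t) * \<delta> (6 * k + 4) + t * ((1 - t) * \<delta> (6 * k + 5) + t * \<delta> (p + 6))))))"
        unfolding walk.simps delta using high by simp
      then show ?thesis
        unfolding row sum image d delta using high True by (simp add: eval_nat_numeral algebra_simps)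
    qed
  next
    case False
    have "\<not> fst x < lorenz_map k p" if x: "x \<in> set (map ?s [Suc p..<12 * k + 7])" for x
    proof -
      obtain q where "q \<in> {Suc p..<12 * k + 7}" "x = ?s q" using x unfolding set_map set_upt by blast
      then show ?thesis using False mono_right[of p q] by simp
    qed
    then have "walk t (lorenz_map k p) (map ?s [Suc p..<12 * k + 7]) c = (if c = lorenz_map k p then 1 else 0)"
      by (intro walk_none)
    then show ?thesis unfolding entry using False by auto
  qed
qed

lemma det_minor_lorenz_map:
  assumes "1 \<le> k"
  shows "det (mat_delete (1\<^sub>m (12 * k + 7) -
    walk_mat t (map (\<lambda>p. (lorenz_map k p, p < 12 * k + 1)) [0..<12 * k + 7])) 0 0) = lorenz_alex k t"
proof -
  let ?M = "walk_mat t (map (\<lambda>p. (lorenz_map k p, p < 12 * k + 1)) [0..<12 * k + 7])"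
  define N where "N = (\<lambda>(i, j). (if i = j then 1 else 0) - (if lorenz_map k (Suc (12 * k) + i) = 0 then 0
      else path_weight k t (lorenz_map k (Suc (12 * k) + i)) j))"
  define X where "X = t ^ (6 * k)"
  define G where "G = (\<Sum>i<k. (t ^ 6) ^ i)"
  let ?b = "1 - t * (1 - t) * (1 + t ^ 2 + t ^ 4) * G" and ?v = "(1 - t) * G"
  have "det (mat_delete (1\<^sub>m (Suc (12 * k + 6)) - ?M) 0 0) = det (mat 6 6 N)"
    unfolding N_def
  proof (rule det_minor_lorenz[where
      S = "\<lambda>p i. if i < (if p < 6 * k then 2 else 6) then (1 - t) * t ^ i else 0"
      and w = "\<lambda>p. if p < 6 * k then t ^ 2 else t ^ 6"])
    show "?M \<in> carrier_mat (Suc (12 * k + 6)) (Suc (12 * k + 6))"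
      by (rule carrier_matI) (simp_all add: walk_mat_def)
    show "p < lorenz_map k p" if "1 \<le> p" "p \<le> 12 * k" for p
      using that by (auto simp: lorenz_map_def)
    show "lorenz_map k (Suc (12 * k) + i) \<le> 12 * k" if "i < 6" for i
      using that assms by (auto simp: lorenz_map_def)
    show "path_weight k t p i = (if i < (if p < 6 * k then 2 else 6) then (1 - t) * t ^ i else 0) +
        (if p < 6 * k then t ^ 2 else t ^ 6) * (if lorenz_map k p \<le> 12 * k then path_weight k t (lorenz_map k p) i
          else if lorenz_map k p = Suc (12 * k) + i then 1 else 0)"
      if "1 \<le> p" "p \<le> 12 * k" "i < 6" for p i
    proof -
      have "path_weight k t q i = (if q = Suc (12 * k) + i then 1 else 0)" if "\<not> q \<le> 12 * k" for q
        using that by (subst path_weight.simps) simp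
      then show ?thesis using that by (subst path_weight.simps) simp
    qed
    show "?M $$ (p, c) = (\<Sum>i<6. (if i < (if p < 6 * k then 2 else 6) then (1 - t) * t ^ i else 0)
         * (if lorenz_map k (Suc (12 * k) + i) = c then 1 else 0))
       + (if lorenz_map k p = c then if p < 6 * k then t ^ 2 else t ^ 6 else 0)"
      if "1 \<le> p" "p \<le> 12 * k" "c \<le> 12 * k + 6" for p c
      using walk_mat_lorenz_map[OF assms, of p c t] that by simp
    show "?M $$ (Suc (12 * k) + i, c) = (if lorenz_map k (Suc (12 * k) + i) = c then 1 else 0)"
      if "i < 6" "c \<le> 12 * k + 6" for i c
      using walk_mat_lorenz_map[OF assms, of "Suc (12 * k) + i" c t] that by simp
  qed
  \<comment> \<open>The first right point is sent to the deleted point 0, so its row is a unit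
    vector.\<close>
  also have "det (mat 6 6 N) = det (mat 5 5 (\<lambda>(i, c). N (Suc i, Suc c)))"
  proof -
    have "N (0, j) = (if j = 0 then 1 else 0)" for j by (simp add: N_def lorenz_map_def)
    then show ?thesis using det_mat_Suc[of 5 N] by (simp add: eval_nat_numeral)
  qed
  \<comment> \<open>Row 0 starts at the point 1 and includes the low steps; row \<open>i > 0\<close>
    starts at \<open>6k + i + 1\<close> and arrives at the right point just before its own, whence
    \<open>- X\<close> below the diagonal.\<close>
  also have "mat 5 5 (\<lambda>(i, c). N (Suc i, Suc c)) =
    mat 5 5 (\<lambda>(i, j). (if i = j then if i = 0 then ?b else 1 else if i = Suc j then - X else 0)
      - (if i = 0 then X * ?v else ?v) * t ^ Suc j)"
  proof (rule cong_mat)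
    fix i j :: nat assume ij: "i < 5" "j < 5"
    show "(case (i, j) of (i, c) \<Rightarrow> N (Suc i, Suc c)) =
      (case (i, j) of (i, j) \<Rightarrow> (if i = j then if i = 0 then ?b else 1 else if i = Suc j then - X else 0)
        - (if i = 0 then X * ?v else ?v) * t ^ Suc j)"
    proof (cases i)
      case 0
      then show ?thesis using ij path_weight_1[of "Suc j" k t]
        by (auto simp: N_def lorenz_map_def X_def G_def algebra_simps)
    next
      case (Suc r)
      have "lorenz_map k (Suc (12 * k) + Suc i) = 6 * k + Suc i"
        using Suc ij by (simp add: lorenz_map_def)
      then show ?thesis using Suc ij path_weight_entry[of "Suc i" "Suc j" k t]
        by (auto simp: N_def X_def G_def algebra_simps)
    qed
  qed auto
  also have "det \<dots> = lorenz_alex k t"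
    unfolding det_bidiagonal_rank_one lorenz_alex_def Let_def X_def[symmetric] G_def[symmetric]
    by (simp add: algebra_simps eval_nat_numeral)
  moreover have "Suc (12 * k + 6) = 12 * k + 7" by simp
  ultimately show ?thesis by (simp only:)
qed

theorem theorem8p1:
  fixes k :: int
  shows "\<exists>W p. modular_knot_word W \<and> is_alexander (length W) (modular_braid W) p \<and>
           (\<exists>d \<le> degree p. coeff p d = k)"
proof -
  obtain n d where n: "1 \<le> n" and d: "d \<le> degree (lorenz_alex n [:0, 1 :: int:])"
    "coeff (lorenz_alex n [:0, 1 :: int:]) d = k"
    using ex_coeff_lorenz_alex by blast
  interpret lorenz_cycle "12 * n + 7" "12 * n + 1" "lorenz_map n"
    using n by (rule lorenz_cycle_lorenz_map)
  have det: "det (mat_delete (1\<^sub>m (12 * n + 7) - burau (12 * n + 7) t (modular_braid word)) 0 0) = lorenz_alex n t" for t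
    unfolding burau_word strands_word by (rule det_minor_lorenz_map[OF n])
  \<comment> \<open>The minor is already normalized, so sign 1 and exponent 0 serve as
    witnesses.\<close>
  have "is_alexander (length word) (modular_braid word) (lorenz_alex n [:0, 1:])"
    unfolding is_alexander_def length_word det
    by (auto simp: coeff_0_lorenz_alex[OF n] poly_int_lorenz_alex lorenz_alex_1 poly_lorenz_alex
        intro!: bexI[of _ 1] exI[of _ "0 :: int"])
  moreover have "modular_knot_word word"
    using primitive_word two_le unfolding modular_knot_word_def length_word by blast
  ultimately show ?thesis using d by blast
qed

end
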